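(* Let $\Gamma$ be a countably infinite discrete group. If $(S_n)_{n\in\mathbb{N}}$ is a countable family of infinite subsets of $\Gamma$, then there exists a free $\Gamma$-flow that is $S_n$-minimal for all $n\in\mathbb{N}$.
   Context: A $\Gamma$-flow is a nonempty compact Hausdorff space $X$ equipped with a continuous action of $\Gamma$. An action of $\Gamma$ on $X$ is free if $\gamma\cdot x\neq x$ for all $x\in X$ and all non-identity $\gamma\in\Gamma$; a $\Gamma$-flow is free if its action is free. For a subset $S\subseteq\Gamma$ (not necessarily a subgroup), a $\Gamma$-flow $X$ is $S$-minimal if for every point $x\in X$ the partial orbit $S\cdot x=\{\sigma\cdot x:\sigma\in S\}$ is dense in $X$. Here $\mathbb{N}=\{0,1,2,\ldots\}$. *)

theory Defs
  imports "HOL-Analysis.Analysis" "HOL-Algebra.Group_Action"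
begin

text \<open>
  A flow of \<open>G\<close> (as a discrete group): a nonempty compact Hausdorff space with a jointly continuous
  left action.  As usual for \<^const>\<open>group_action\<close>, each \<open>\<phi> g\<close> with \<open>g\<close> in the carrier is a
  bijection of \<open>topspace X\<close> that takes the value \<^const>\<open>undefined\<close> outside of it.
\<close>

definition flow :: "('g, 'm) monoid_scheme \<Rightarrow> 'x topology \<Rightarrow> ('g \<Rightarrow> 'x \<Rightarrow> 'x) \<Rightarrow> bool"
  where "flow G X \<phi> \<longleftrightarrow>
    topspace X \<noteq> {} \<and> compact_space X \<and> Hausdorff_space X \<and>
    group_action G (topspace X) \<phi> \<and>
    continuous_map (prod_topology (discrete_topology (carrier G)) X) X (\<lambda>(g, x). \<phi> g x)"

definition free_action :: "('g, 'm) monoid_scheme \<Rightarrow> 'x set \<Rightarrow> ('g \<Rightarrow> 'x \<Rightarrow> 'x) \<Rightarrow> bool"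
  where "free_action G E \<phi> \<longleftrightarrow> (\<forall>g \<in> carrier G - {\<one>\<^bsub>G\<^esub>}. \<forall>x \<in> E. \<phi> g x \<noteq> x)"

definition free_flow :: "('g, 'm) monoid_scheme \<Rightarrow> 'x topology \<Rightarrow> ('g \<Rightarrow> 'x \<Rightarrow> 'x) \<Rightarrow> bool"
  where "free_flow G X \<phi> \<longleftrightarrow> flow G X \<phi> \<and> free_action G (topspace X) \<phi>"

text \<open>\<open>S\<close> is an arbitrary subset of \<open>carrier G\<close>.\<close>

definition minimal_on :: "'g set \<Rightarrow> 'x topology \<Rightarrow> ('g \<Rightarrow> 'x \<Rightarrow> 'x) \<Rightarrow> bool"
  where "minimal_on S X \<phi> \<longleftrightarrow>
    (\<forall>x \<in> topspace X. X closure_of ((\<lambda>s. \<phi> s x) ` S) = topspace X)"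

text \<open>
  HOL cannot quantify existentially over types, so the points of a flow whose existence is asserted
  have to be taken from a fixed type.  The following one loses no generality for flows of a
  countable group that are minimal on some set \<open>S\<close>: such a flow \<open>X\<close> has a countable dense subset
  \<open>range d\<close> with \<open>d :: nat \<Rightarrow> 'x\<close>, and because \<open>X\<close> is Hausdorff and regular, the map
  \<open>x \<mapsto> {A. x \<in> X closure_of (d ` A)}\<close> is an injection of \<open>topspace X\<close> into \<open>nat set set\<close>, along
  which topology and action can be transported.
\<close>

type_synonym flow_point = "nat set set"

end

theory Submission
  imports Defs "HOL-Probability.Product_PMF"
begin

text \<open>
  Let \<open>\<Gamma>\<close> be the group.  The flow is the closure of the orbit of one point \<open>z\<close> in the compact space of
  maps \<open>\<Gamma> \<times> \<Gamma> \<rightarrow> {0, 1, 2}\<close>, on which \<open>\<Gamma>\<close> acts by \<open>(h y)(x, \<gamma>) = y (x h, \<gamma>)\<close>.  Two properties of \<open>z\<close>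
  make it work (\<open>recurrent_colouring\<close>).

  \<^item> Properness: \<open>z (\<gamma> x, \<gamma>) \<noteq> z (x, \<gamma>)\<close> for \<open>\<gamma> \<noteq> 1\<close> and all \<open>x\<close>.  This is a closed condition that is
    invariant under the action, so all \<open>y\<close> in the orbit closure satisfy \<open>y (\<gamma>, \<gamma>) \<noteq> y (1, \<gamma>)\<close>, and hence
    \<open>\<gamma> y \<noteq> y\<close>: the flow is free.
  \<^item> Recurrence: for every \<open>n\<close>, every \<open>h\<close> and every finite window there is a finite \<open>F \<subseteq> S n\<close> such that each
    translate \<open>F g\<close> contains some \<open>s g\<close> for which \<open>(s g) z\<close> agrees with \<open>h z\<close> on the window.  By finiteness
    of \<open>F\<close> this passes to the orbit closure: for each of its points \<open>y\<close> some \<open>s y\<close> with \<open>s \<in> F\<close> agrees with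
    \<open>h z\<close> on the window, so \<open>S n y\<close> is dense.

  The point \<open>z\<close> is the union of an increasing sequence of finite patterns \<open>p\<^sub>0 \<subseteq> p\<^sub>1 \<subseteq> \<dots>\<close>, chosen together
  with finite sets \<open>F\<^sub>k\<close> such that \<open>p\<^sub>k\<close> must occur at some point of every translate \<open>F\<^sub>k g\<close>.  Later patterns
  have to obey all earlier constraints although they, and all their required copies, are arbitrarily large in
  comparison with the earlier \<open>F\<^sub>k\<close>.  What keeps the construction going is the invariant
  \<open>flexible\<close>: a family \<open>\<G>\<close> of finite patterns comes with a finite set \<open>C\<close> such that any finitely many
  members whose \<open>C\<close>-neighbourhoods are disjoint extend to one member of \<open>\<G>\<close> over any prescribed window,
  and this member stays within the \<open>C\<close>-neighbourhood of the data.

  Imposing one more constraint preserves the invariant (\<open>force_recurrence\<close>).  The new family consists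
  of the gluings \<open>u\<close> of old members such that every translate \<open>F g\<close> either contains an occurrence of \<open>p\<close> in \<open>u\<close>,
  or has at least half of its points far away from \<open>u\<close>.  The second alternative leaves room for
  satisfying the constraint later, which is possible by \<open>sparse_hitting_set\<close>: for a suitable large
  and spread out \<open>F \<subseteq> S n\<close>, the Lovasz local lemma yields a sparse set \<open>T\<close> of places for copies of \<open>p\<close> that
  meets all translates \<open>F g\<close> with enough room, and whose neighbourhood nevertheless covers at most half
  of any translate, so that the copies block no constraint for which they do not provide an occurrence.
\<close>

section \<open>Independent marks and the local lemma\<close>

text \<open>
  A random subset of a finite set \<open>M\<close> is described by its indicator function \<open>\<omega>\<close>, whose values at
  the points of \<open>M\<close> are independent.
\<close>

definition depends_only :: "('a \<Rightarrow> bool) set \<Rightarrow> 'a set \<Rightarrow> bool"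
  where "depends_only A V \<longleftrightarrow> (\<forall>\<omega> \<omega>'. (\<forall>x\<in>V. \<omega> x = \<omega>' x) \<longrightarrow> (\<omega> \<in> A \<longleftrightarrow> \<omega>' \<in> A))"

abbreviation marking :: "'a set \<Rightarrow> real \<Rightarrow> ('a \<Rightarrow> bool) pmf"
  where "marking M q \<equiv> Pi_pmf M False (\<lambda>_. bernoulli_pmf q)"

lemma depends_only_mono: "depends_only A V \<Longrightarrow> V \<subseteq> W \<Longrightarrow> depends_only A W"
  unfolding depends_only_def by blast

lemma depends_only_Compl: "depends_only A V \<Longrightarrow> depends_only (- A) V"
  unfolding depends_only_def by blast

lemma depends_only_INT: "(\<And>i. i \<in> I \<Longrightarrow> depends_only (A i) (V i)) \<Longrightarrow> depends_only (\<Inter>i\<in>I. A i) (\<Union>i\<in>I. V i)"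
  unfolding depends_only_def by (auto; blast)

lemma depends_only_UN: "(\<And>i. i \<in> I \<Longrightarrow> depends_only (A i) (V i)) \<Longrightarrow> depends_only (\<Union>i\<in>I. A i) (\<Union>i\<in>I. V i)"
  unfolding depends_only_def by (auto; blast)

lemma depends_only_Un:
  "depends_only A V \<Longrightarrow> depends_only B V \<Longrightarrow> depends_only (A \<union> B) V"
  unfolding depends_only_def by blast

text \<open>
  The marking of \<open>M\<close> is a pair of independent markings of \<open>V\<close> and of \<open>M - V\<close>, and the two events become
  a rectangle.
\<close>

lemma prob_Int_disjoint_coordinates:
  assumes M: "finite M" "V \<subseteq> M" "W \<subseteq> M" "V \<inter> W = {}"
    and A: "depends_only A V" and B: "depends_only B W"
  shows "measure_pmf.prob (marking M q) (A \<inter> B) =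
    measure_pmf.prob (marking M q) A * measure_pmf.prob (marking M q) B"
proof -
  let ?p = "\<lambda>V. marking V q"
  let ?h = "\<lambda>(f, g) x. if x \<in> V then f x else g x"
  have M_eq: "M = V \<union> (M - V)" using M by auto
  have eq: "?p M = map_pmf ?h (pair_pmf (?p V) (?p (M - V)))"
    using Pi_pmf_union[of V "M - V" False "\<lambda>_. bernoulli_pmf q"] M finite_subset[OF M(2,1)]
      by (subst M_eq) auto
  have "?h (f, g) \<in> A \<longleftrightarrow> f \<in> A" for f g
  proof -
    have "\<forall>x\<in>V. ?h (f, g) x = f x" by auto
    then show ?thesis using A unfolding depends_only_def by blast
  qed
  then have A': "?h -` A = A \<times> UNIV"
    by (intro Set.set_eqI) (simp only: vimage_eq split_paired_all mem_Times_iff fst_conv snd_conv UNIV_I simp_thms)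
  have "?h (f, g) \<in> B \<longleftrightarrow> g \<in> B" for f g
  proof -
    have "\<forall>x\<in>W. ?h (f, g) x = g x" using M(4) by auto
    then show ?thesis using B unfolding depends_only_def by blast
  qed
  then have B': "?h -` B = UNIV \<times> B"
    by (intro Set.set_eqI) (simp only: vimage_eq split_paired_all mem_Times_iff fst_conv snd_conv UNIV_I simp_thms)
  have prod: "measure_pmf.prob (pair_pmf P P') (X \<times> Y) = measure_pmf.prob P X * measure_pmf.prob P' Y"
    for P P' :: "('a \<Rightarrow> bool) pmf" and X Y
  proof -
    have "measure_pmf.prob (pair_pmf P P') (X \<times> Y)
        = measure_pmf.prob (pair_pmf P P') ((X \<inter> set_pmf P) \<times> (Y \<inter> set_pmf P'))"
      by (intro measure_pmf.finite_measure_eq_AE) (auto simp: AE_measure_pmf_iff)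
    also have "\<dots> = measure_pmf.prob P X * measure_pmf.prob P' Y"
      by (subst measure_pmf_prob_product)
         (auto simp: measure_Int_set_pmf intro: countable_subset[OF _ countable_set_pmf])
    finally show ?thesis .
  qed
  show ?thesis
    unfolding eq measure_map_pmf vimage_Int A' B' using prod[of "?p V" "?p (M - V)"]
    by (simp add: Times_Int_Times)
qed

lemma prob_INT_disjoint_coordinates:
  assumes "finite M" "finite I" "disjoint_family_on V I"
    and "\<And>i. i \<in> I \<Longrightarrow> V i \<subseteq> M" "\<And>i. i \<in> I \<Longrightarrow> depends_only (A i) (V i)"
  shows "measure_pmf.prob (marking M q) (\<Inter>i\<in>I. A i) = (\<Prod>i\<in>I. measure_pmf.prob (marking M q) (A i))"
  using assms(2-)
proof (induction rule: finite_induct)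
  case (insert i I)
  have IH: "measure_pmf.prob (marking M q) (\<Inter>i\<in>I. A i) = (\<Prod>i\<in>I. measure_pmf.prob (marking M q) (A i))"
    using insert by (auto simp: disjoint_family_on_def)
  have "V i \<inter> (\<Union>j\<in>I. V j) = {}"
    using insert by (auto simp: disjoint_family_on_def)
  then have "measure_pmf.prob (marking M q) (A i \<inter> (\<Inter>i\<in>I. A i))
      = measure_pmf.prob (marking M q) (A i) * measure_pmf.prob (marking M q) (\<Inter>i\<in>I. A i)"
    using insert assms(1)
    by (intro prob_Int_disjoint_coordinates[of M "V i" "\<Union>j\<in>I. V j"] depends_only_INT) auto
  then show ?case using insert IH by simp
qed simp

text \<open>
  The symmetric Lovasz local lemma.  By induction on \<open>J\<close>, the conditional probability of \<open>A i\<close> under the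
  condition that no \<open>A j\<close> with \<open>j \<in> J\<close> happens is at most \<open>2 p\<close>: dropping the at most \<open>d\<close> indices that
  share a coordinate with \<open>i\<close> makes \<open>A i\<close> independent of the condition, and, by the induction hypothesis and
  the union bound, loses no more than half of the mass of the condition.
\<close>

lemma lovasz_local_lemma:
  fixes p :: real and d :: nat
  assumes "finite M" "finite I"
    and V: "\<And>i. i \<in> I \<Longrightarrow> V i \<subseteq> M" "\<And>i. i \<in> I \<Longrightarrow> depends_only (A i) (V i)"
    and p: "\<And>i. i \<in> I \<Longrightarrow> measure_pmf.prob (marking M q) (A i) \<le> p"
    and d: "\<And>i. i \<in> I \<Longrightarrow> card {j \<in> I. V i \<inter> V j \<noteq> {}} \<le> d"
    and pd: "0 \<le> p" "1 \<le> d" "4 * p * d \<le> 1"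
  shows "\<exists>\<omega>. \<forall>i\<in>I. \<omega> \<notin> A i"
proof -
  define P where "P = measure_pmf.prob (marking M q)"
  define N where "N J = (\<Inter>j\<in>J. - A j)" for J
  have N_dep: "depends_only (N J) (\<Union>j\<in>J. V j)" if "J \<subseteq> I" for J
    unfolding N_def using that by (intro depends_only_INT depends_only_Compl V(2)) auto
  have P_mono: "P X \<le> P Y" if "X \<subseteq> Y" for X Y
    unfolding P_def using that by (intro measure_pmf.finite_measure_mono) auto
  have P_nonneg: "0 \<le> P X" for X unfolding P_def by simp
  \<comment> \<open>The conditional probability bound, multiplied out.\<close>
  have cond: "P (A i \<inter> N J) \<le> 2 * p * P (N J)" if "J \<subseteq> I" "i \<in> I" for J i
    using that
  proof (induction "card J" arbitrary: J i rule: less_induct)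
    case less
    define J1 where "J1 = {j \<in> J. V i \<inter> V j \<noteq> {}}"
    define J2 where "J2 = J - J1"
    have fin: "finite J" "finite J1" "finite J2"
      using finite_subset[OF less.prems(1) assms(2)] unfolding J1_def J2_def by auto
    have J2I: "J2 \<subseteq> I" using less.prems unfolding J2_def by auto
    have "P (A i \<inter> N J) \<le> P (A i \<inter> N J2)"
      by (intro P_mono) (auto simp: N_def J2_def)
    also have "\<dots> = P (A i) * P (N J2)"
      unfolding P_def using V(1) less.prems J2I
      by (intro prob_Int_disjoint_coordinates[OF assms(1) _ _ _ V(2) N_dep])
         (auto simp: J1_def J2_def)
    also have "\<dots> \<le> p * P (N J2)"
      using p[OF less.prems(2)] P_nonneg unfolding P_def by (intro mult_right_mono) auto
    finally have le: "P (A i \<inter> N J) \<le> p * P (N J2)" .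
    have "P (N J2) \<le> 2 * P (N J)"
    proof (cases "J1 = {}")
      case True
      then show ?thesis using P_nonneg[of "N J"] by (simp add: J2_def)
    next
      case False
      have "card J2 < card J"
        using False fin(1) unfolding J1_def J2_def by (intro psubset_card_mono) auto
      then have IH: "P (A j \<inter> N J2) \<le> 2 * p * P (N J2)" if "j \<in> J1" for j
        using less.hyps[OF _ J2I] that less.prems(1) by (auto simp: J1_def)
      have "card J1 \<le> card {j \<in> I. V i \<inter> V j \<noteq> {}}"
        using assms(2) less.prems unfolding J1_def by (intro card_mono) auto
      then have card: "real (card J1) \<le> d" using d[OF less.prems(2)] by simp
      have "N J2 \<subseteq> N J \<union> (\<Union>j\<in>J1. A j \<inter> N J2)" by (auto simp: N_def J2_def)
      then have "P (N J2) \<le> P (N J \<union> (\<Union>j\<in>J1. A j \<inter> N J2))" by (rule P_mono)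
      also have "\<dots> \<le> P (N J) + P (\<Union>j\<in>J1. A j \<inter> N J2)"
        unfolding P_def by (intro measure_Un_le) auto
      also have "P (\<Union>j\<in>J1. A j \<inter> N J2) \<le> (\<Sum>j\<in>J1. P (A j \<inter> N J2))"
        unfolding P_def using fin by (intro measure_pmf.finite_measure_subadditive_finite) auto
      also have "\<dots> \<le> (\<Sum>j\<in>J1. 2 * p * P (N J2))" by (intro sum_mono IH)
      also have "\<dots> = card J1 * (2 * p * P (N J2))" by simp
      also have "\<dots> \<le> d * (2 * p * P (N J2))"
        using card P_nonneg pd by (intro mult_right_mono) auto
      also have "\<dots> = (4 * p * d) * P (N J2) / 2" by simp
      also have "\<dots> \<le> 1 * P (N J2) / 2"
        using pd(3) P_nonneg by (intro divide_right_mono mult_right_mono) auto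
      finally show ?thesis by simp
    qed
    then have "p * P (N J2) \<le> p * (2 * P (N J))" using pd by (intro mult_left_mono) auto
    with le show ?case by simp
  qed
  have "p * 1 \<le> p * d" using pd by (intro mult_left_mono) auto
  then have p2: "2 * p < 1" using pd by simp
  have "0 < P (N J)" if "J \<subseteq> I" for J
    using finite_subset[OF that assms(2)] that
  proof (induction rule: finite_induct)
    case empty
    then show ?case by (simp add: N_def P_def)
  next
    case (insert i J)
    have "N (insert i J) = N J - A i \<inter> N J" by (auto simp: N_def)
    then have "P (N (insert i J)) = P (N J) - P (A i \<inter> N J)"
      unfolding P_def by (simp add: measure_pmf.finite_measure_Diff)
    also have "\<dots> \<ge> (1 - 2 * p) * P (N J)"
      using cond[of J i] insert.prems by (simp add: algebra_simps)
    finally show ?case using insert p2 by (smt (verit) insert_subset mult_pos_pos)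
  qed
  from this[of I] have "N I \<noteq> {}" by (auto simp: P_def)
  then show ?thesis unfolding N_def by auto
qed

lemma prob_marked:
  assumes "finite M" "x \<in> M" "0 \<le> q" "q \<le> 1"
  shows "measure_pmf.prob (marking M q) {\<omega>. \<omega> x} = q"
    and "measure_pmf.prob (marking M q) {\<omega>. \<not> \<omega> x} = 1 - q"
proof -
  have "measure_pmf.prob (marking M q) {\<omega>. B (\<omega> x)} = measure_pmf.prob (bernoulli_pmf q) {b. B b}" for B
  proof -
    have "map_pmf (\<lambda>\<omega>. \<omega> x) (marking M q) = bernoulli_pmf q"
      using assms by (subst Pi_pmf_component) auto
    then have "measure_pmf.prob (bernoulli_pmf q) {b. B b} = measure_pmf.prob (map_pmf (\<lambda>\<omega>. \<omega> x) (marking M q)) {b. B b}"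
      by simp
    then show ?thesis by (simp add: vimage_def)
  qed
  from this[of "\<lambda>b. b"] this[of Not]
  have "measure_pmf.prob (marking M q) {\<omega>. \<omega> x} = measure_pmf.prob (bernoulli_pmf q) {True}"
    "measure_pmf.prob (marking M q) {\<omega>. \<not> \<omega> x} = measure_pmf.prob (bernoulli_pmf q) {False}"
    by (simp_all only: singleton_conv2[symmetric] eq_True simp_thms)
  then show "measure_pmf.prob (marking M q) {\<omega>. \<omega> x} = q"
    "measure_pmf.prob (marking M q) {\<omega>. \<not> \<omega> x} = 1 - q"
    using assms by (simp_all add: measure_pmf_single)
qed

lemma prob_isolated_mark:
  assumes "finite M" "finite B" "insert x B \<subseteq> M" "0 \<le> q" "q \<le> 1"
  shows "measure_pmf.prob (marking M q) {\<omega>. \<omega> x \<and> (\<forall>y\<in>B. y \<noteq> x \<longrightarrow> \<not> \<omega> y)} \<ge> q * (1 - q) ^ card B"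
proof -
  define X where "X y = {\<omega>. if y = x then \<omega> y else \<not> \<omega> y}" for y
  have "{\<omega>. \<omega> x \<and> (\<forall>y\<in>B. y \<noteq> x \<longrightarrow> \<not> \<omega> y)} = (\<Inter>y\<in>insert x (B - {x}). X y)"
    by (auto simp: X_def)
  also have "measure_pmf.prob (marking M q) \<dots>
      = (\<Prod>y\<in>insert x (B - {x}). measure_pmf.prob (marking M q) (X y))"
    using assms by (intro prob_INT_disjoint_coordinates[where V = "\<lambda>y. {y}"])
      (auto simp: disjoint_family_on_def depends_only_def X_def)
  also have "\<dots> = measure_pmf.prob (marking M q) (X x) * (\<Prod>y\<in>B - {x}. measure_pmf.prob (marking M q) (X y))"
    using assms by (subst prod.insert) auto
  also have "(\<Prod>y\<in>B - {x}. measure_pmf.prob (marking M q) (X y)) = (\<Prod>y\<in>B - {x}. 1 - q)"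
    using assms by (intro prod.cong refl) (auto simp: X_def prob_marked)
  also have "measure_pmf.prob (marking M q) (X x) = q"
    using assms by (simp add: X_def prob_marked)
  also have "(\<Prod>y\<in>B - {x}. 1 - q) = (1 - q) ^ card (B - {x})" by simp
  finally have "measure_pmf.prob (marking M q) {\<omega>. \<omega> x \<and> (\<forall>y\<in>B. y \<noteq> x \<longrightarrow> \<not> \<omega> y)}
      = q * (1 - q) ^ card (B - {x})" .
  moreover have "(1 - q) ^ card B \<le> (1 - q) ^ card (B - {x})"
    using assms by (intro power_decreasing card_mono) auto
  ultimately show ?thesis using assms by (simp add: mult_left_mono)
qed

lemma prob_some_mark_le:
  fixes q :: real
  assumes "finite M" "finite B" "B \<subseteq> M" "0 \<le> q" "q \<le> 1"
  shows "measure_pmf.prob (marking M q) {\<omega>. \<exists>y\<in>B. \<omega> y} \<le> card B * q"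
proof -
  have "{\<omega>. \<exists>y\<in>B. \<omega> y} = (\<Union>y\<in>B. {\<omega>. \<omega> y})" by auto
  also have "measure_pmf.prob (marking M q) \<dots> \<le> (\<Sum>y\<in>B. measure_pmf.prob (marking M q) {\<omega>. \<omega> y})"
    using assms by (intro measure_pmf.finite_measure_subadditive_finite) auto
  also have "\<dots> = (\<Sum>y\<in>B. q)" using assms by (intro sum.cong refl prob_marked) auto
  finally show ?thesis by simp
qed

text \<open>
  The numerical condition of the local lemma: failure probabilities decay geometrically in the size
  parameter \<open>m\<close>, whereas the number of interacting events grows only quadratically.
\<close>

lemma eventually_small_geometric:
  fixes c B :: real
  assumes "0 \<le> c" "c < 1"
  shows "\<exists>m\<ge>1. 8 * c ^ m * (2 * real m * B)\<^sup>2 \<le> 1"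
proof -
  have "(\<lambda>n. real n * sqrt c ^ n) \<longlonglongrightarrow> 0"
    using assms by (intro powser_times_n_limit_0) (auto simp: real_sqrt_lt_1_iff)
  then have "(\<lambda>n. 32 * B\<^sup>2 * (real n * sqrt c ^ n)\<^sup>2) \<longlonglongrightarrow> 32 * B\<^sup>2 * 0\<^sup>2"
    by (intro tendsto_intros)
  then have "eventually (\<lambda>n. 32 * B\<^sup>2 * (real n * sqrt c ^ n)\<^sup>2 < 1) sequentially"
    by (rule order_tendstoD) simp
  then obtain m where m: "m \<ge> 1" "32 * B\<^sup>2 * (real m * sqrt c ^ m)\<^sup>2 < 1"
    using eventually_ge_at_top[of "1::nat"] by (metis (mono_tags, lifting) eventually_at_top_linorder linear)
  have "(sqrt c ^ m)\<^sup>2 = c ^ m" using assms by (metis power_commutes power_mult real_sqrt_pow2 mult.commute)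
  then show ?thesis using m by (intro exI[of _ m]) (simp add: power_mult_distrib algebra_simps)
qed

section \<open>Sparse hitting sets in a group\<close>

text \<open>
  The combinatorial part is carried out in a group whose carrier is a whole type, which saves all
  membership side conditions.
\<close>

locale whole_group = Groups.group mul e iv
  for mul :: "'a \<Rightarrow> 'a \<Rightarrow> 'a" (infixl "\<cdot>" 70) and e :: 'a and iv :: "'a \<Rightarrow> 'a"
begin

lemma e_right [simp]: "x \<cdot> e = x"
  by (metis assoc left_inverse right_inverse group_left_neutral)

lemma e_left [simp]: "e \<cdot> x = x"
  by (rule group_left_neutral)

lemma iv_cancel [simp]: "iv x \<cdot> (x \<cdot> y) = y" "x \<cdot> (iv x \<cdot> y) = y"
  by (simp_all flip: assoc)

definition set_prod :: "'a set \<Rightarrow> 'a set \<Rightarrow> 'a set" (infixl "\<odot>" 75)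
  where "A \<odot> B = {a \<cdot> b |a b. a \<in> A \<and> b \<in> B}"

lemma set_prodI: "a \<in> A \<Longrightarrow> b \<in> B \<Longrightarrow> a \<cdot> b \<in> A \<odot> B"
  unfolding set_prod_def by blast

lemma set_prodE: "x \<in> A \<odot> B \<Longrightarrow> (\<And>a b. x = a \<cdot> b \<Longrightarrow> a \<in> A \<Longrightarrow> b \<in> B \<Longrightarrow> P) \<Longrightarrow> P"
  unfolding set_prod_def by blast

lemma set_prod_eq_image: "A \<odot> B = (\<lambda>(a, b). a \<cdot> b) ` (A \<times> B)"
  unfolding set_prod_def by auto

lemma set_prod_singleton: "A \<odot> {x} = (\<lambda>a. a \<cdot> x) ` A"
  unfolding set_prod_def by auto

lemma finite_set_prod [simp, intro]: "finite A \<Longrightarrow> finite B \<Longrightarrow> finite (A \<odot> B)"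
  by (simp add: set_prod_eq_image)

lemma set_prod_assoc: "A \<odot> B \<odot> C = A \<odot> (B \<odot> C)"
  unfolding set_prod_def by (auto; metis assoc)

lemma set_prod_mono: "A \<subseteq> A' \<Longrightarrow> B \<subseteq> B' \<Longrightarrow> A \<odot> B \<subseteq> A' \<odot> B'"
  unfolding set_prod_def by blast

lemma set_prod_Un_right: "A \<odot> (B \<union> C) = A \<odot> B \<union> A \<odot> C"
  unfolding set_prod_def by blast

lemma card_set_prod_le: "finite A \<Longrightarrow> finite B \<Longrightarrow> card (A \<odot> B) \<le> card A * card B"
  unfolding set_prod_eq_image by (metis card_image_le card_cartesian_product finite_cartesian_product)

lemma card_set_prod_singleton [simp]: "card (A \<odot> {x}) = card A"
  unfolding set_prod_singleton by (intro card_image) (auto simp: inj_on_def right_cancel)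

lemma set_prod_UN_right: "A \<odot> (\<Union>i\<in>I. B i) = (\<Union>i\<in>I. A \<odot> B i)"
  unfolding set_prod_def by blast

lemma set_prod_translates_Int:
  "A \<odot> {t} \<inter> B \<odot> {t} = (A \<inter> B) \<odot> {t}"
  by (auto simp: set_prod_singleton right_cancel)

lemma set_prod_meetE:
  assumes "A \<odot> B \<inter> C \<odot> D \<noteq> {}"
  obtains a b c d where "a \<in> A" "b \<in> B" "c \<in> C" "d \<in> D" "a \<cdot> b = c \<cdot> d"
  using assms unfolding set_prod_def by blast

lemma subset_set_prod:
  assumes "e \<in> C"
  shows "X \<subseteq> C \<odot> X"
proof
  fix x assume "x \<in> X"
  then have "e \<cdot> x \<in> C \<odot> X" by (rule set_prodI[OF assms])
  then show "x \<in> C \<odot> X" by simp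
qed

lemma set_prod_eq_UN: "A \<odot> T = (\<Union>t\<in>T. A \<odot> {t})"
  unfolding set_prod_def by blast

text \<open>
  Only finitely many elements are in conflict with those chosen before, so a greedy choice from the
  infinite set never gets stuck.
\<close>

lemma spread_subset:
  assumes "infinite S" "finite Q"
  shows "\<exists>F\<subseteq>S. card F = n \<and> finite F \<and> disjoint_family_on (\<lambda>f. Q \<odot> {f}) F"
proof (induction n)
  case 0
  show ?case by (intro exI[of _ "{}"]) (simp add: disjoint_family_on_def)
next
  case (Suc n)
  then obtain F where F: "F \<subseteq> S" "card F = n" "finite F" "disjoint_family_on (\<lambda>f. Q \<odot> {f}) F"
    by blast
  have "finite (F \<union> iv ` Q \<odot> (Q \<odot> F))" using F assms by auto
  then have "S - (F \<union> iv ` Q \<odot> (Q \<odot> F)) \<noteq> {}"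
    using assms(1) Diff_infinite_finite infinite_imp_nonempty by blast
  then obtain s where s: "s \<in> S" "s \<notin> F" "s \<notin> iv ` Q \<odot> (Q \<odot> F)" by blast
  have "Q \<odot> {s} \<inter> Q \<odot> {f} = {}" if "f \<in> F" for f
  proof (rule equals0I)
    fix x assume "x \<in> Q \<odot> {s} \<inter> Q \<odot> {f}"
    then have "x \<in> (\<lambda>a. a \<cdot> s) ` Q" "x \<in> (\<lambda>a. a \<cdot> f) ` Q" by (simp_all add: set_prod_singleton)
    then obtain a b where ab: "a \<in> Q" "b \<in> Q" and eq: "a \<cdot> s = b \<cdot> f" by fast
    have "iv a \<cdot> (a \<cdot> s) = iv a \<cdot> (b \<cdot> f)" by (simp only: eq)
    then have "s = iv a \<cdot> (b \<cdot> f)" by (simp only: iv_cancel)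
    moreover have "iv a \<cdot> (b \<cdot> f) \<in> iv ` Q \<odot> (Q \<odot> F)"
      using that by (intro set_prodI imageI ab)
    ultimately show False using s(3) by simp
  qed
  then have "disjoint_family_on (\<lambda>f. Q \<odot> {f}) (insert s F)"
    using F(4) unfolding disjoint_family_on_def by blast
  then show ?case using F s by (intro exI[of _ "insert s F"]) auto
qed

text \<open>
  Mark points independently with a small probability \<open>q\<close> and
  let \<open>T\<close> consist of the marked points outside \<open>Z\<close> without another marked point in their
  \<open>A\<close>-neighbourhood.  The set \<open>F\<close> has \<open>2 m\<close> elements with disjoint \<open>Q\<close>-neighbourhoods, so what
  happens at different points of a translate \<open>F g\<close> is independent.  If \<open>m\<close> of these points lie outside \<open>Z\<close>,
  then \<open>T\<close> misses all of them with probability at most \<open>(1 - a)\<^sup>m\<close>, where \<open>a\<close> bounds the probability of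
  being an isolated marked point from below.  A given point lies in \<open>E T\<close> with
  probability at most \<open>1/8\<close>, so more than half of the translate does with probability at most
  \<open>4\<^sup>m (1/8)\<^sup>m\<close>.  Each of these bad events involves at most \<open>2 m |Q|\<close> points and thus interacts with at most
  \<open>(2 m |Q|)\<^sup>2\<close> others, and the local lemma applies for large \<open>m\<close>.
\<close>

lemma sparse_hitting_set:
  assumes "finite A" "finite E" "infinite S"
  obtains F where "finite F" "F \<subseteq> S" "F \<noteq> {}"
    "\<And>H Z. finite H \<Longrightarrow> \<exists>T. finite T \<and> T \<inter> Z = {} \<and>
        (\<forall>x\<in>T. \<forall>y\<in>T. y \<in> A \<odot> {x} \<longrightarrow> y = x) \<and>
        (\<forall>g\<in>H. 2 * card (F \<odot> {g} \<inter> Z) \<le> card F \<longrightarrow> F \<odot> {g} \<inter> T \<noteq> {}) \<and>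
        (\<forall>g. 2 * card (F \<odot> {g} \<inter> E \<odot> T) \<le> card F)"
proof -
  \<comment> \<open>Whether \<open>x\<close> is an isolated marked point, or may lie in \<open>E T\<close>, depends on the marks in \<open>Q \<odot> {x}\<close> only.\<close>
  define Q where "Q = insert e (A \<union> iv ` E)"
  \<comment> \<open>The summand 1 keeps \<open>q\<close> positive when \<open>E\<close> is empty.\<close>
  define q :: real where "q = 1 / (8 * (card E + 1))"
  define a where "a = q * (1 - q) ^ card A"
  define c where "c = max (1 - a) (1 / 2)"
  have finQ: "finite Q" using assms by (simp add: Q_def)
  have q: "0 < q" "q < 1" by (simp_all add: q_def)
  have "(1 - q) ^ card A \<le> 1" using q by (intro power_le_one) auto
  then have "a \<le> q" unfolding a_def using q by (simp add: mult_left_le)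
  then have "a < 1" using q(2) by simp
  moreover have "0 < a" using q by (simp add: a_def)
  ultimately have a: "0 < a" "a < 1" by auto
  then have c: "0 \<le> c" "c < 1" "1 - a \<le> c" "1 / 2 \<le> c" by (auto simp: c_def)
  obtain m where m: "m \<ge> 1" "8 * c ^ m * (2 * real m * real (card Q))\<^sup>2 \<le> 1"
    using eventually_small_geometric[OF c(1,2)] by blast
  obtain F where F: "F \<subseteq> S" "card F = 2 * m" "finite F" "disjoint_family_on (\<lambda>f. Q \<odot> {f}) F"
    using spread_subset[OF assms(3) finQ] by blast
  have blocks: "disjoint_family_on (\<lambda>f. Q \<odot> {f \<cdot> g}) F'" if "F' \<subseteq> F" for F' g
    unfolding disjoint_family_on_def
  proof (intro ballI impI)
    fix f f' assume "f \<in> F'" "f' \<in> F'" "f \<noteq> f'"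
    then have "Q \<odot> {f} \<inter> Q \<odot> {f'} = {}" using F(4) that unfolding disjoint_family_on_def by blast
    then show "Q \<odot> {f \<cdot> g} \<inter> Q \<odot> {f' \<cdot> g} = {}"
      by (auto simp: set_prod_singleton right_cancel simp flip: assoc)
  qed
  show ?thesis
  proof (rule that[OF F(3,1)])
    show "F \<noteq> {}" using F(2) m(1) by auto
    fix H Z :: "'a set" assume H: "finite H"
    define D where "D = F \<odot> H"
    \<comment> \<open>\<open>T\<close> will be part of \<open>D\<close>, so the translates \<open>F g\<close> with \<open>g \<notin> I\<close> do not meet \<open>E T\<close>.\<close>
    define I where "I = H \<union> iv ` F \<odot> (E \<odot> D)"
    define V where "V g = Q \<odot> (F \<odot> {g})" for g
    define M where "M = (\<Union>g\<in>I. V g)"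
    define iso where "iso x = {\<omega>. \<omega> x \<and> (\<forall>y\<in>A \<odot> {x}. y \<noteq> x \<longrightarrow> \<not> \<omega> y)}" for x
    define near where "near x = {\<omega>. \<exists>y\<in>iv ` E \<odot> {x}. \<omega> y}" for x
    define unhit where "unhit g = (if g \<in> H \<and> 2 * card (F \<odot> {g} \<inter> Z) \<le> card F
        then \<Inter>f\<in>{f \<in> F. f \<cdot> g \<notin> Z}. - iso (f \<cdot> g) else {})" for g
    define dense where "dense g = (\<Union>F'\<in>{F'. F' \<subseteq> F \<and> card F' = m}. \<Inter>f\<in>F'. near (f \<cdot> g))" for g
    define P where "P = measure_pmf.prob (marking M q)"
    have fin: "finite D" "finite I" "finite M" "\<And>g. finite (V g)"
      using H F assms finQ by (auto simp: D_def I_def M_def V_def)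
    have P_mono: "P X \<le> P Y" if "X \<subseteq> Y" for X Y
      unfolding P_def using that by (intro measure_pmf.finite_measure_mono) auto
    have QV: "Q \<odot> {f \<cdot> g} \<subseteq> V g" if "f \<in> F" for f g
      unfolding V_def using that by (intro set_prod_mono order_refl) (auto simp: set_prod_singleton)
    have AQ: "A \<odot> {x} \<subseteq> Q \<odot> {x}" and EQ: "iv ` E \<odot> {x} \<subseteq> Q \<odot> {x}" and xQ: "x \<in> Q \<odot> {x}" for x
      by (auto simp: Q_def set_prod_singleton)
    have VM: "V g \<subseteq> M" if "g \<in> I" for g using that by (auto simp: M_def)
    have dep_iso: "depends_only (iso x) (Q \<odot> {x})" and dep_near: "depends_only (near x) (Q \<odot> {x})" for x
      using AQ[of x] EQ[of x] xQ[of x] unfolding depends_only_def iso_def near_def by blast+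
    have P_unhit: "P (unhit g) \<le> c ^ m" if g: "g \<in> I" for g
    proof (cases "g \<in> H \<and> 2 * card (F \<odot> {g} \<inter> Z) \<le> card F")
      case True
      define F' where "F' = {f \<in> F. f \<cdot> g \<notin> Z}"
      have F': "F' \<subseteq> F" "finite F'" using F(3) by (auto simp: F'_def)
      have "card (F - F') = card ((\<lambda>f. f \<cdot> g) ` (F - F'))"
        by (intro card_image[symmetric]) (auto simp: inj_on_def right_cancel)
      also have "(\<lambda>f. f \<cdot> g) ` (F - F') = F \<odot> {g} \<inter> Z"
        by (auto simp: F'_def set_prod_singleton)
      finally have "m \<le> card F'" using True F(2) card_Diff_subset[OF F'(2,1)] by linarith
      have "P (unhit g) = (\<Prod>f\<in>F'. P (- iso (f \<cdot> g)))"
        using True QV VM[OF g] F' unfolding unhit_def P_def F'_def[symmetric]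
        by (simp, intro prob_INT_disjoint_coordinates[where V = "\<lambda>f. Q \<odot> {f \<cdot> g}"] fin F' blocks
            depends_only_Compl dep_iso) blast
      also have "\<dots> \<le> (\<Prod>f\<in>F'. c)"
      proof (intro prod_mono conjI)
        fix f assume f: "f \<in> F'"
        show "0 \<le> P (- iso (f \<cdot> g))" by (simp add: P_def)
        have "f \<in> F" using f F'(1) by blast
        then have "insert (f \<cdot> g) (A \<odot> {f \<cdot> g}) \<subseteq> M"
          using AQ[of "f \<cdot> g"] xQ[of "f \<cdot> g"] QV[of f g] VM[OF g] by blast
        then have "a \<le> P (iso (f \<cdot> g))"
          unfolding a_def P_def iso_def
          using prob_isolated_mark[of M "A \<odot> {f \<cdot> g}" "f \<cdot> g" q] fin(3) assms(1) q by simp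
        moreover have "P (- iso (f \<cdot> g)) = 1 - P (iso (f \<cdot> g))"
          unfolding P_def using measure_pmf.prob_compl[of "iso (f \<cdot> g)" "marking M q"]
          by (simp add: Compl_eq_Diff_UNIV)
        ultimately show "P (- iso (f \<cdot> g)) \<le> c" using c(3) by simp
      qed
      also have "\<dots> \<le> c ^ m" using c \<open>m \<le> card F'\<close> by (simp add: power_decreasing)
      finally show ?thesis .
    qed (use c in \<open>auto simp: unhit_def P_def\<close>)
    have P_dense: "P (dense g) \<le> c ^ m" if g: "g \<in> I" for g
    proof -
      let ?FF = "{F'. F' \<subseteq> F \<and> card F' = m}"
      have finFF: "finite ?FF" using F(3) by auto
      have "P (near (f \<cdot> g)) \<le> 1 / 8" if "f \<in> F" for f
      proof -
        have "P (near (f \<cdot> g)) \<le> card (iv ` E \<odot> {f \<cdot> g}) * q"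
          unfolding P_def near_def using fin assms q EQ[of "f \<cdot> g"] QV[OF that, of g] VM[OF g]
          by (intro prob_some_mark_le) auto
        also have "\<dots> \<le> card E * q"
          using q assms by (intro mult_right_mono) (auto intro: card_image_le)
        also have "\<dots> \<le> 1 / 8" by (simp add: q_def field_simps)
        finally show ?thesis .
      qed
      then have "P (\<Inter>f\<in>F'. near (f \<cdot> g)) \<le> (1 / 8) ^ m" if F': "F' \<in> ?FF" for F'
      proof -
        have "P (\<Inter>f\<in>F'. near (f \<cdot> g)) = (\<Prod>f\<in>F'. P (near (f \<cdot> g)))"
          unfolding P_def
        proof (intro prob_INT_disjoint_coordinates[where V = "\<lambda>f. Q \<odot> {f \<cdot> g}"] fin dep_near)
          show "finite F'" "disjoint_family_on (\<lambda>f. Q \<odot> {f \<cdot> g}) F'"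
            using F' F(3) finite_subset blocks by auto
          show "Q \<odot> {f \<cdot> g} \<subseteq> M" if "f \<in> F'" for f
            using F' that QV[of f g] VM[OF g] by auto
        qed
        also have "\<dots> \<le> (\<Prod>f\<in>F'. 1 / 8)"
          using F' \<open>\<And>f. f \<in> F \<Longrightarrow> P (near (f \<cdot> g)) \<le> 1 / 8\<close>
          by (intro prod_mono) (auto simp: P_def)
        finally show ?thesis using F' by simp
      qed
      then have "(\<Sum>F'\<in>?FF. P (\<Inter>f\<in>F'. near (f \<cdot> g))) \<le> (\<Sum>F'\<in>?FF. (1 / 8) ^ m)"
        by (intro sum_mono) auto
      moreover have "P (dense g) \<le> (\<Sum>F'\<in>?FF. P (\<Inter>f\<in>F'. near (f \<cdot> g)))"
        unfolding dense_def P_def using finFF by (intro measure_pmf.finite_measure_subadditive_finite) auto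
      ultimately have le: "P (dense g) \<le> real (card ?FF) * (1 / 8) ^ m" by simp
      have "card ?FF \<le> card (Pow F)" using F(3) by (intro card_mono) auto
      also have "\<dots> = 4 ^ m" using F by (simp add: card_Pow power_mult)
      finally have "real (card ?FF) \<le> real (4 ^ m)" by (simp only: of_nat_le_iff)
      then have card: "real (card ?FF) \<le> 4 ^ m" by simp
      note le
      also have "real (card ?FF) * (1 / 8) ^ m \<le> 4 ^ m * (1 / 8) ^ m"
        using card by (intro mult_right_mono) auto
      also have "\<dots> = (1 / 2) ^ m" by (simp flip: power_mult_distrib)
      also have "\<dots> \<le> c ^ m" using c by (intro power_mono) auto
      finally show ?thesis .
    qed
    have "\<exists>\<omega>. \<forall>g\<in>I. \<omega> \<notin> unhit g \<union> dense g"
    proof (rule lovasz_local_lemma[where V = V and M = M and q = q and p = "2 * c ^ m"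
          and d = "(card Q * (2 * m))\<^sup>2"])
      show "finite M" "finite I" by (rule fin)+
      show "V g \<subseteq> M" if "g \<in> I" for g using VM[OF that] .
      show "depends_only (unhit g \<union> dense g) (V g)" for g
      proof (rule depends_only_Un)
        have "depends_only (\<Inter>f\<in>{f \<in> F. f \<cdot> g \<notin> Z}. - iso (f \<cdot> g)) (\<Union>f\<in>{f \<in> F. f \<cdot> g \<notin> Z}. Q \<odot> {f \<cdot> g})"
          by (intro depends_only_INT depends_only_Compl dep_iso)
        then have "depends_only (\<Inter>f\<in>{f \<in> F. f \<cdot> g \<notin> Z}. - iso (f \<cdot> g)) (V g)"
          by (rule depends_only_mono) (use QV in blast)
        then show "depends_only (unhit g) (V g)" by (simp add: unhit_def depends_only_def)
        have "depends_only (dense g) (\<Union>F'\<in>{F'. F' \<subseteq> F \<and> card F' = m}. \<Union>f\<in>F'. Q \<odot> {f \<cdot> g})"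
          unfolding dense_def by (intro depends_only_UN depends_only_INT dep_near)
        then show "depends_only (dense g) (V g)"
          by (rule depends_only_mono) (use QV in blast)
      qed
      show "measure_pmf.prob (marking M q) (unhit g \<union> dense g) \<le> 2 * c ^ m" if "g \<in> I" for g
        using measure_Un_le[of "unhit g" "marking M q" "dense g"] P_unhit[OF that] P_dense[OF that]
        unfolding P_def by simp
      show "card {h \<in> I. V g \<inter> V h \<noteq> {}} \<le> (card Q * (2 * m))\<^sup>2" for g
      proof -
        let ?QF = "Q \<odot> F"
        have finQF: "finite ?QF" using finQ F by auto
        have "{h \<in> I. V g \<inter> V h \<noteq> {}} \<subseteq> (\<lambda>(x, y). iv x \<cdot> (y \<cdot> g)) ` (?QF \<times> ?QF)"
        proof
          fix h assume "h \<in> {h \<in> I. V g \<inter> V h \<noteq> {}}"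
          then obtain z where "z \<in> ?QF \<odot> {g}" "z \<in> ?QF \<odot> {h}" by (auto simp: V_def set_prod_assoc)
          then obtain x y where "x \<in> ?QF" "y \<in> ?QF" "y \<cdot> g = x \<cdot> h" by (auto simp: set_prod_singleton)
          then have "h = iv x \<cdot> (y \<cdot> g)" by simp
          then show "h \<in> (\<lambda>(x, y). iv x \<cdot> (y \<cdot> g)) ` (?QF \<times> ?QF)"
            using \<open>x \<in> ?QF\<close> \<open>y \<in> ?QF\<close> by auto
        qed
        then have "card {h \<in> I. V g \<inter> V h \<noteq> {}} \<le> card (?QF \<times> ?QF)"
          using finQF by (intro surj_card_le) auto
        also have "\<dots> = (card ?QF)\<^sup>2" by (simp add: card_cartesian_product power2_eq_square)
        also have "\<dots> \<le> (card Q * (2 * m))\<^sup>2"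
          using card_set_prod_le[OF finQ F(3)] F(2) by (intro power_mono) auto
        finally show ?thesis .
      qed
      show "0 \<le> 2 * c ^ m" using c by simp
      have "card Q > 0" using finQ by (auto simp: Q_def card_gt_0_iff)
      then show "1 \<le> (card Q * (2 * m))\<^sup>2" using m(1) by simp
      show "4 * (2 * c ^ m) * real ((card Q * (2 * m))\<^sup>2) \<le> 1"
        using m(2) by (simp add: algebra_simps power_mult_distrib)
    qed
    then obtain \<omega> where \<omega>: "\<And>g. g \<in> I \<Longrightarrow> \<omega> \<notin> unhit g" "\<And>g. g \<in> I \<Longrightarrow> \<omega> \<notin> dense g" by auto
    define T where "T = {x \<in> D - Z. \<omega> \<in> iso x}"
    show "\<exists>T. finite T \<and> T \<inter> Z = {} \<and>
        (\<forall>x\<in>T. \<forall>y\<in>T. y \<in> A \<odot> {x} \<longrightarrow> y = x) \<and>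
        (\<forall>g\<in>H. 2 * card (F \<odot> {g} \<inter> Z) \<le> card F \<longrightarrow> F \<odot> {g} \<inter> T \<noteq> {}) \<and>
        (\<forall>g. 2 * card (F \<odot> {g} \<inter> E \<odot> T) \<le> card F)"
    proof (intro exI[of _ T] conjI ballI impI allI)
      show "finite T" "T \<inter> Z = {}" using fin by (auto simp: T_def)
      show "y = x" if "x \<in> T" "y \<in> T" "y \<in> A \<odot> {x}" for x y
        using that unfolding T_def iso_def by blast
      show "F \<odot> {g} \<inter> T \<noteq> {}" if g: "g \<in> H" "2 * card (F \<odot> {g} \<inter> Z) \<le> card F" for g
      proof -
        have "\<omega> \<notin> unhit g" using \<omega>(1)[of g] g by (auto simp: I_def)
        then obtain f where f: "f \<in> F" "f \<cdot> g \<notin> Z" "\<omega> \<in> iso (f \<cdot> g)" using g by (auto simp: unhit_def)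
        then have "f \<cdot> g \<in> T" using g(1) by (auto simp: T_def D_def intro: set_prodI)
        then show ?thesis using f(1) by (auto simp: set_prod_singleton)
      qed
      show "2 * card (F \<odot> {g} \<inter> E \<odot> T) \<le> card F" for g
      proof (rule ccontr)
        assume many: "\<not> 2 * card (F \<odot> {g} \<inter> E \<odot> T) \<le> card F"
        define F1 where "F1 = {f \<in> F. f \<cdot> g \<in> E \<odot> T}"
        have "F \<odot> {g} \<inter> E \<odot> T = F1 \<odot> {g}" by (auto simp: F1_def set_prod_singleton)
        then have "m \<le> card F1" using many F(2) by simp
        then obtain F' where F': "F' \<subseteq> F1" "card F' = m" by (meson obtain_subset_with_card_n)
        have near: "\<omega> \<in> near (f \<cdot> g)" if "f \<in> F1" for f
        proof -
          from that obtain y t where yt: "y \<in> E" "t \<in> T" "f \<cdot> g = y \<cdot> t"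
            by (auto simp: F1_def elim: set_prodE)
          then have "t = iv y \<cdot> (f \<cdot> g)" by simp
          moreover have "\<omega> t" using yt by (auto simp: T_def iso_def)
          ultimately show ?thesis using yt(1) unfolding near_def by (auto simp: set_prod_singleton)
        qed
        obtain f where "f \<in> F'" using F' m(1) by fastforce
        then have f: "f \<in> F" "f \<cdot> g \<in> E \<odot> T" using F' by (auto simp: F1_def)
        then have "f \<cdot> g \<in> E \<odot> D" unfolding T_def by (auto elim!: set_prodE intro: set_prodI)
        then have "iv f \<cdot> (f \<cdot> g) \<in> iv ` F \<odot> (E \<odot> D)" by (rule set_prodI[OF imageI[OF f(1)]])
        then have "g \<in> I" by (simp add: I_def)
        moreover have "\<omega> \<in> dense g"
          unfolding dense_def using F' near by (auto simp: F1_def intro!: exI[of _ F'])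
        ultimately show False using \<omega>(2) by blast
      qed
    qed
  qed
qed

end

section \<open>Patterns and gluing\<close>

text \<open>
  A pattern is the graph of a partial labelling: gluing is union and extension is inclusion.  Uniqueness
  of labels is part of the notion of a colouring below.
\<close>

type_synonym ('x, 'b) pattern = "('x \<times> 'b) set"

definition supp :: "('x, 'b) pattern \<Rightarrow> 'x set"
  where "supp q = fst ` q"

lemma supp_Un [simp]: "supp (p \<union> q) = supp p \<union> supp q"
  by (auto simp: supp_def)

lemma supp_Union: "supp (\<Union>\<F>) = (\<Union>q\<in>\<F>. supp q)"
  by (auto simp: supp_def)

lemma supp_mono: "p \<subseteq> q \<Longrightarrow> supp p \<subseteq> supp q"
  by (auto simp: supp_def)

lemma finite_supp [simp]: "finite q \<Longrightarrow> finite (supp q)"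
  by (simp add: supp_def)

lemma supp_memI: "(x, b) \<in> q \<Longrightarrow> x \<in> supp q"
  by (force simp: supp_def)

context whole_group
begin

definition shift :: "'a \<Rightarrow> ('a, 'b) pattern \<Rightarrow> ('a, 'b) pattern"
  where "shift t q = (\<lambda>(x, b). (x \<cdot> t, b)) ` q"

lemma supp_shift: "supp (shift t q) = supp q \<odot> {t}"
  by (force simp: supp_def shift_def set_prod_singleton)

lemma mem_shift: "(x, b) \<in> shift t q \<longleftrightarrow> (x \<cdot> iv t, b) \<in> q"
proof
  assume "(x, b) \<in> shift t q"
  then show "(x \<cdot> iv t, b) \<in> q" by (auto simp: shift_def assoc)
next
  assume "(x \<cdot> iv t, b) \<in> q"
  then have "(x \<cdot> iv t \<cdot> t, b) \<in> shift t q" by (force simp: shift_def)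
  then show "(x, b) \<in> shift t q" by (simp add: assoc)
qed

lemma shift_shift: "shift s (shift t q) = shift (t \<cdot> s) q"
  by (auto simp: shift_def image_image case_prod_unfold assoc)

lemma shift_e [simp]: "shift e q = q"
  by (auto simp: shift_def case_prod_unfold)

lemma shift_mono: "p \<subseteq> q \<Longrightarrow> shift t p \<subseteq> shift t q"
  by (auto simp: shift_def)

text \<open>
  Patterns are translated from the right and their neighbourhoods \<open>C \<odot> supp a\<close> are taken from the left, which
  makes being far apart invariant under translation.  A larger \<open>C\<close> admits fewer gluings.
\<close>

definition glued :: "'a set \<Rightarrow> ('a, 'b) pattern set \<Rightarrow> ('a, 'b) pattern \<Rightarrow> bool"
  where "glued C \<G> u \<longleftrightarrow> (\<exists>\<F>\<subseteq>\<G>. finite \<F> \<and> u = \<Union>\<F> \<and>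
    (\<forall>a\<in>\<F>. \<forall>b\<in>\<F>. a \<noteq> b \<longrightarrow> (C \<odot> supp a) \<inter> (C \<odot> supp b) = {}))"

text \<open>
  The bound on \<open>supp q\<close> is what makes the property inheritable.  The next constraint uses a finite set
  \<open>F\<close> that is chosen after \<open>C\<close>; as the extension \<open>q\<close> stays within a distance that is already known,
  places for new copies can be chosen in advance, and those that are not among the data extended by \<open>q\<close> are
  far from \<open>q\<close>.
\<close>

definition flexible :: "('a, 'b) pattern set \<Rightarrow> 'a set \<Rightarrow> bool"
  where "flexible \<G> C \<longleftrightarrow> finite C \<and> e \<in> C \<and>
    (\<forall>q\<in>\<G>. finite q \<and> (\<forall>t. shift t q \<in> \<G>)) \<and>
    (\<forall>u B. glued C \<G> u \<longrightarrow> finite B \<longrightarrow>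
      (\<exists>q\<in>\<G>. u \<subseteq> q \<and> B \<subseteq> supp q \<and> supp q \<subseteq> C \<odot> (B \<union> supp u)))"

lemma flexibleD:
  assumes "flexible \<G> C"
  shows "finite C" "e \<in> C" "q \<in> \<G> \<Longrightarrow> finite q" "q \<in> \<G> \<Longrightarrow> shift t q \<in> \<G>"
    "glued C \<G> u \<Longrightarrow> finite B \<Longrightarrow> \<exists>q\<in>\<G>. u \<subseteq> q \<and> B \<subseteq> supp q \<and> supp q \<subseteq> C \<odot> (B \<union> supp u)"
  using assms unfolding flexible_def by blast+

lemma glued_single: "q \<in> \<G> \<Longrightarrow> glued C \<G> q"
  unfolding glued_def by (intro exI[of _ "{q}"]) auto

lemma glued_trans:
  assumes "glued C' \<G>' u" "C \<subseteq> C'" and sub: "\<And>q. q \<in> \<G>' \<Longrightarrow> glued C \<G> q"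
  shows "glued C \<G> u"
proof -
  obtain \<F> where \<F>: "\<F> \<subseteq> \<G>'" "finite \<F>" "u = \<Union>\<F>"
    and sep: "\<And>a b. a \<in> \<F> \<Longrightarrow> b \<in> \<F> \<Longrightarrow> a \<noteq> b \<Longrightarrow> (C' \<odot> supp a) \<inter> (C' \<odot> supp b) = {}"
    using assms(1) unfolding glued_def by blast
  have "\<forall>a\<in>\<F>. \<exists>\<H>\<subseteq>\<G>. finite \<H> \<and> a = \<Union>\<H> \<and>
      (\<forall>b\<in>\<H>. \<forall>c\<in>\<H>. b \<noteq> c \<longrightarrow> (C \<odot> supp b) \<inter> (C \<odot> supp c) = {})"
    using sub \<F>(1) unfolding glued_def by blast
  then obtain \<H> where \<H>: "\<And>a. a \<in> \<F> \<Longrightarrow> \<H> a \<subseteq> \<G> \<and> finite (\<H> a) \<and> a = \<Union>(\<H> a) \<and>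
      (\<forall>b\<in>\<H> a. \<forall>c\<in>\<H> a. b \<noteq> c \<longrightarrow> (C \<odot> supp b) \<inter> (C \<odot> supp c) = {})"
    by metis
  then have \<H>1: "\<H> a \<subseteq> \<G>" and \<H>2: "finite (\<H> a)" if "a \<in> \<F>" for a
    using that by simp_all
  have sep': "(C \<odot> supp b) \<inter> (C \<odot> supp c) = {}"
    if "a \<in> \<F>" "a' \<in> \<F>" "b \<in> \<H> a" "c \<in> \<H> a'" "b \<noteq> c" for a a' b c
  proof (cases "a = a'")
    case True
    then show ?thesis using \<H> that by blast
  next
    case False
    have "b \<subseteq> a" "c \<subseteq> a'" using \<H> that by blast+
    then have "C \<odot> supp b \<subseteq> C' \<odot> supp a" "C \<odot> supp c \<subseteq> C' \<odot> supp a'"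
      using assms(2) by (simp_all add: set_prod_mono supp_mono)
    then show ?thesis using sep[OF that(1,2) False] by blast
  qed
  have "(\<Union>a\<in>\<F>. \<Union>(\<H> a)) = (\<Union>a\<in>\<F>. a)" using \<H> by (intro SUP_cong refl) metis
  then have "u = (\<Union>a\<in>\<F>. \<Union>(\<H> a))" using \<F>(3) by simp
  also have "\<dots> = \<Union>(\<Union>a\<in>\<F>. \<H> a)" by blast
  finally have "u = \<Union>(\<Union>a\<in>\<F>. \<H> a)" .
  moreover have "(\<Union>a\<in>\<F>. \<H> a) \<subseteq> \<G>" "finite (\<Union>a\<in>\<F>. \<H> a)"
    using \<H>1 \<H>2 \<F>(2) by (blast, simp)
  ultimately show ?thesis unfolding glued_def using sep' by (intro exI[of _ "\<Union>a\<in>\<F>. \<H> a"]) auto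
qed

lemma glued_Un:
  assumes "glued C \<G> u" "glued C \<G> v" and disj: "(C \<odot> supp u) \<inter> (C \<odot> supp v) = {}"
  shows "glued C \<G> (u \<union> v)"
proof -
  obtain \<F> where \<F>: "\<F> \<subseteq> \<G>" "finite \<F>" "u = \<Union>\<F>"
    and sepF: "\<And>a b. a \<in> \<F> \<Longrightarrow> b \<in> \<F> \<Longrightarrow> a \<noteq> b \<Longrightarrow> (C \<odot> supp a) \<inter> (C \<odot> supp b) = {}"
    using assms(1) unfolding glued_def by blast
  obtain \<H> where \<H>: "\<H> \<subseteq> \<G>" "finite \<H>" "v = \<Union>\<H>"
    and sepH: "\<And>a b. a \<in> \<H> \<Longrightarrow> b \<in> \<H> \<Longrightarrow> a \<noteq> b \<Longrightarrow> (C \<odot> supp a) \<inter> (C \<odot> supp b) = {}"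
    using assms(2) unfolding glued_def by blast
  have "(C \<odot> supp a) \<inter> (C \<odot> supp b) = {}" if "a \<in> \<F>" "b \<in> \<H>" for a b
  proof -
    have "a \<subseteq> u" "b \<subseteq> v" using that \<F>(3) \<H>(3) by auto
    then have "C \<odot> supp a \<subseteq> C \<odot> supp u" "C \<odot> supp b \<subseteq> C \<odot> supp v"
      by (simp_all add: set_prod_mono supp_mono)
    then show ?thesis using disj by blast
  qed
  then have "(C \<odot> supp a) \<inter> (C \<odot> supp b) = {}" if "a \<in> \<F> \<union> \<H>" "b \<in> \<F> \<union> \<H>" "a \<noteq> b" for a b
    using that sepF sepH by (metis Int_commute UnE)
  then show ?thesis unfolding glued_def using \<F> \<H>
    by (intro exI[of _ "\<F> \<union> \<H>"]) auto
qed

lemma glued_shift: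
  assumes "glued C \<G> u" "\<And>q. q \<in> \<G> \<Longrightarrow> shift t q \<in> \<G>"
  shows "glued C \<G> (shift t u)"
proof -
  obtain \<F> where \<F>: "\<F> \<subseteq> \<G>" "finite \<F>" "u = \<Union>\<F>"
    and sep: "\<And>a b. a \<in> \<F> \<Longrightarrow> b \<in> \<F> \<Longrightarrow> a \<noteq> b \<Longrightarrow> (C \<odot> supp a) \<inter> (C \<odot> supp b) = {}"
    using assms(1) unfolding glued_def by blast
  have "(C \<odot> supp (shift t a)) \<inter> (C \<odot> supp (shift t b)) = {}"
    if "a \<in> \<F>" "b \<in> \<F>" "shift t a \<noteq> shift t b" for a b
  proof -
    have "(C \<odot> supp a) \<inter> (C \<odot> supp b) = {}" using sep that by blast
    then show ?thesis
      by (simp add: supp_shift set_prod_translates_Int flip: set_prod_assoc) (simp add: set_prod_def)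
  qed
  moreover have "shift t u = \<Union>(shift t ` \<F>)" by (auto simp: shift_def \<F>(3))
  ultimately show ?thesis unfolding glued_def using \<F> assms(2)
    by (intro exI[of _ "shift t ` \<F>"]) auto
qed

lemma glued_translates:
  assumes "p \<in> \<G>" "\<And>t. shift t p \<in> \<G>" "finite T"
    and "\<And>s t. s \<in> T \<Longrightarrow> t \<in> T \<Longrightarrow> s \<noteq> t \<Longrightarrow> (C \<odot> (supp p \<odot> {s})) \<inter> (C \<odot> (supp p \<odot> {t})) = {}"
  shows "glued C \<G> (\<Union>t\<in>T. shift t p)"
  unfolding glued_def
proof (intro exI[of _ "(\<lambda>t. shift t p) ` T"] conjI ballI impI)
  fix a b assume "a \<in> (\<lambda>t. shift t p) ` T" "b \<in> (\<lambda>t. shift t p) ` T" "a \<noteq> b"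
  then obtain s t where "s \<in> T" "t \<in> T" "s \<noteq> t" "a = shift s p" "b = shift t p" by blast
  then show "(C \<odot> supp a) \<inter> (C \<odot> supp b) = {}" using assms(4) by (simp add: supp_shift)
qed (use assms in auto)

lemma finite_glued: "glued C \<G> u \<Longrightarrow> (\<And>q. q \<in> \<G> \<Longrightarrow> finite q) \<Longrightarrow> finite u"
  unfolding glued_def by auto

lemma supp_translates: "supp (\<Union>t\<in>T. shift t p) = supp p \<odot> T"
  unfolding supp_Union by (auto simp: supp_shift set_prod_def)

section \<open>Forcing a pattern to recur\<close>

text \<open>
  The members of the new family \<open>\<G>'\<close> are the gluings \<open>u\<close> of members of \<open>\<G>\<close> for which every translate
  \<open>F g\<close> either is met, which means that \<open>p\<close> occurs in \<open>u\<close> at some point of \<open>F g\<close>, or has at least half of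
  its points outside \<open>N supp u\<close>.  A translate inside \<open>supp u\<close> is therefore met.

  If \<open>C'\<close> is large in comparison with \<open>F\<close>, then a translate can come near at most one
  piece of a \<open>C'\<close>-gluing, and \<open>\<G>'\<close> is closed under \<open>C'\<close>-gluings.  It remains to extend a single \<open>u\<close> to a
  given window \<open>B\<close>.  Let \<open>T\<close> be a sparse set off \<open>N supp u\<close> that meets all relevant translates with enough
  room.  Place copies of \<open>p\<close> at those points \<open>T0\<close> of \<open>T\<close> that are near the window or \<open>u\<close>, extend everything
  to some \<open>q \<in> \<G>\<close>, and then add copies at the points \<open>R\<close> of \<open>T - T0\<close> that lie in translates near \<open>q\<close>.
  These are far from \<open>q\<close>, so the result is a gluing again.  A translate that comes near \<open>q\<close> is met, in \<open>u\<close> or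
  at a point of \<open>T0\<close> or \<open>R\<close>.  Any other translate comes near the copies at \<open>R\<close> only, and these are so sparse that
  they cover at most half of it.
\<close>

lemma force_recurrence:
  fixes \<G> :: "('a, 'b) pattern set"
  assumes flex: "flexible \<G> C" and p: "p \<in> \<G>" and S: "infinite S"
  obtains F \<G>' C' where "finite F" "F \<subseteq> S" "flexible \<G>' C'" "C \<subseteq> C'" "iv ` F \<subseteq> C'"
    "\<And>q. q \<in> \<G>' \<Longrightarrow> glued C \<G> q"
    "\<And>q g. q \<in> \<G>' \<Longrightarrow> F \<odot> {g} \<subseteq> supp q \<Longrightarrow> \<exists>s\<in>F. shift (s \<cdot> g) p \<subseteq> q"
    "\<exists>q\<in>\<G>'. p \<subseteq> q"
proof -
  note flexD = flexibleD[OF flex]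
  define W where "W = supp p"
  \<comment> \<open>The copy of \<open>p\<close> at a point outside \<open>N Z\<close> is \<open>C\<close>-far from \<open>Z\<close>; copies at different points of
    an \<open>A\<close>-separated set are still \<open>C\<close>-far from each other after one of them is enlarged by \<open>C\<close>.\<close>
  define N where "N = insert e (iv ` W \<odot> (iv ` C \<odot> C))"
  define A where "A = iv ` W \<odot> (iv ` C \<odot> (C \<odot> (C \<odot> W)))"
  have fin: "finite W" "finite C" "finite N" "finite A" "finite (N \<odot> W)" "e \<in> C" "e \<in> N"
    using flexD(1,2) flexD(3)[OF p] by (auto simp: W_def N_def A_def)
  obtain F where F: "finite F" "F \<subseteq> S" "F \<noteq> {}"
    and hit: "\<And>H Z. finite H \<Longrightarrow> \<exists>T. finite T \<and> T \<inter> Z = {} \<and>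
        (\<forall>x\<in>T. \<forall>y\<in>T. y \<in> A \<odot> {x} \<longrightarrow> y = x) \<and>
        (\<forall>g\<in>H. 2 * card (F \<odot> {g} \<inter> Z) \<le> card F \<longrightarrow> F \<odot> {g} \<inter> T \<noteq> {}) \<and>
        (\<forall>g. 2 * card (F \<odot> {g} \<inter> (N \<odot> W) \<odot> T) \<le> card F)"
    using sparse_hitting_set[OF fin(4,5) S] by metis
  define met where "met u g \<longleftrightarrow> (\<exists>s\<in>F. shift (s \<cdot> g) p \<subseteq> u)" for u g
  define \<G>' where "\<G>' = {u. glued C \<G> u \<and> (\<forall>g. met u g \<or> 2 * card (F \<odot> {g} \<inter> N \<odot> supp u) \<le> card F)}"
  \<comment> \<open>An a priori bound: \<open>supp q\<close> will lie in the \<open>J\<close>-neighbourhood of the window and \<open>u\<close>.  It tells which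
    translates have to be considered before \<open>q\<close> is known.\<close>
  define J where "J = C \<union> C \<odot> (W \<odot> (iv ` W \<odot> (iv ` C \<odot> (C \<odot> C))))"
  define C' where "C' = C \<union> iv ` F \<odot> N \<union> J \<union> W \<odot> (F \<odot> (iv ` F \<odot> (N \<odot> J)))"
  have met_mono: "met u g \<Longrightarrow> u \<subseteq> v \<Longrightarrow> met v g" for u v g unfolding met_def by blast
  have "C \<subseteq> C'" by (auto simp: C'_def)
  have "iv ` F \<subseteq> C'"
    using set_prodI[OF imageI fin(7), of _ F iv] by (force simp: C'_def)
  have \<G>'_glued: "glued C \<G> q" if "q \<in> \<G>'" for q using that by (simp add: \<G>'_def)
  have \<G>'_met: "met q g" if "q \<in> \<G>'" "F \<odot> {g} \<subseteq> supp q" for q g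
  proof (rule ccontr)
    assume "\<not> met q g"
    then have "2 * card (F \<odot> {g} \<inter> N \<odot> supp q) \<le> card F" using that(1) by (auto simp: \<G>'_def)
    moreover have "supp q \<subseteq> N \<odot> supp q" using fin(7) by (rule subset_set_prod)
    ultimately have "2 * card (F \<odot> {g}) \<le> card F" using that(2) by (simp add: Int_absorb2)
    then show False using F by (simp add: card_gt_0_iff)
  qed
  have closed: "u \<in> \<G>'" if u: "glued C' \<G>' u" for u
  proof -
    obtain \<F> where \<F>: "\<F> \<subseteq> \<G>'" "finite \<F>" "u = \<Union>\<F>"
      and sep: "\<And>a b. a \<in> \<F> \<Longrightarrow> b \<in> \<F> \<Longrightarrow> a \<noteq> b \<Longrightarrow> (C' \<odot> supp a) \<inter> (C' \<odot> supp b) = {}"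
      using u unfolding glued_def by blast
    have "2 * card (F \<odot> {g} \<inter> N \<odot> supp u) \<le> card F" if unmet: "\<not> met u g" for g
    proof (cases "F \<odot> {g} \<inter> N \<odot> supp u = {}")
      case False
      have "N \<odot> supp u = (\<Union>a\<in>\<F>. N \<odot> supp a)" unfolding \<F>(3) supp_Union set_prod_UN_right ..
      then obtain a where a: "a \<in> \<F>" "F \<odot> {g} \<inter> N \<odot> supp a \<noteq> {}" using False by blast
      have g_in: "g \<in> C' \<odot> supp b" if meet: "F \<odot> {g} \<inter> N \<odot> supp b \<noteq> {}" for b
      proof -
        obtain f n y where fny: "f \<in> F" "n \<in> N" "y \<in> supp b" "f \<cdot> g = n \<cdot> y"
          by (rule set_prod_meetE[OF meet]) auto
        then have "iv f \<cdot> (f \<cdot> g) = (iv f \<cdot> n) \<cdot> y" by (simp only: assoc)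
        then have "g = (iv f \<cdot> n) \<cdot> y" by simp
        moreover have "iv f \<cdot> n \<in> C'" using fny by (auto simp: C'_def intro: set_prodI)
        ultimately show ?thesis using fny(3) by (auto intro: set_prodI)
      qed
      have "F \<odot> {g} \<inter> N \<odot> supp b = {}" if "b \<in> \<F>" "b \<noteq> a" for b
        using g_in[of b] g_in[OF a(2)] sep[OF a(1) that(1)] that(2) by blast
      then have "F \<odot> {g} \<inter> N \<odot> supp u = F \<odot> {g} \<inter> N \<odot> supp a"
        unfolding \<open>N \<odot> supp u = (\<Union>a\<in>\<F>. N \<odot> supp a)\<close> using a(1) by blast
      moreover have "\<not> met a g" using unmet met_mono a(1) \<F>(3) by blast
      ultimately show ?thesis using a(1) \<F>(1) by (auto simp: \<G>'_def)
    qed simp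
    moreover have "glued C \<G> u" using u \<open>C \<subseteq> C'\<close> \<G>'_glued by (rule glued_trans)
    ultimately show ?thesis by (auto simp: \<G>'_def)
  qed
  have shift_\<G>': "shift t q \<in> \<G>'" if "q \<in> \<G>'" for t q
  proof -
    have "met (shift t q) g \<or> 2 * card (F \<odot> {g} \<inter> N \<odot> supp (shift t q)) \<le> card F" for g
    proof -
      have "met q (g \<cdot> iv t) \<or> 2 * card (F \<odot> {g \<cdot> iv t} \<inter> N \<odot> supp q) \<le> card F"
        using that by (auto simp: \<G>'_def)
      then show ?thesis
      proof
        assume "met q (g \<cdot> iv t)"
        then obtain s where s: "s \<in> F" "shift (s \<cdot> (g \<cdot> iv t)) p \<subseteq> q" by (auto simp: met_def)
        have "shift (s \<cdot> g) p = shift t (shift (s \<cdot> (g \<cdot> iv t)) p)"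
          by (simp add: shift_shift assoc)
        also have "\<dots> \<subseteq> shift t q" by (rule shift_mono[OF s(2)])
        finally show ?thesis using s(1) by (auto simp: met_def)
      next
        assume le: "2 * card (F \<odot> {g \<cdot> iv t} \<inter> N \<odot> supp q) \<le> card F"
        have "F \<odot> {g} = F \<odot> {g \<cdot> iv t} \<odot> {t}"
          by (auto simp: set_prod_singleton image_image assoc)
        then have "F \<odot> {g} \<inter> N \<odot> supp (shift t q) = (F \<odot> {g \<cdot> iv t} \<inter> N \<odot> supp q) \<odot> {t}"
          by (simp add: supp_shift flip: set_prod_translates_Int set_prod_assoc)
        then show ?thesis using le by simp
      qed
    qed
    then show ?thesis using glued_shift[OF \<G>'_glued[OF that] flexD(4)] by (auto simp: \<G>'_def)
  qed
  have extend: "\<exists>q\<in>\<G>'. u \<subseteq> q \<and> B \<subseteq> supp q \<and> supp q \<subseteq> C' \<odot> (B \<union> supp u)"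
    if u: "u \<in> \<G>'" and B: "finite B" for u B
  proof -
    define B0 where "B0 = B \<union> supp u"
    have "finite u" using \<G>'_glued[OF u] flexD(3) by (rule finite_glued)
    then have finB0: "finite B0" using B by (simp add: B0_def)
    have "finite (iv ` F \<odot> (N \<odot> (J \<odot> B0)))" using F fin finB0 by (simp add: J_def)
    from hit[OF this, of "N \<odot> supp u"] obtain T where T: "finite T" "T \<inter> N \<odot> supp u = {}"
      and T_sep: "\<forall>x\<in>T. \<forall>y\<in>T. y \<in> A \<odot> {x} \<longrightarrow> y = x"
      and T_hit: "\<forall>g\<in>iv ` F \<odot> (N \<odot> (J \<odot> B0)).
         2 * card (F \<odot> {g} \<inter> N \<odot> supp u) \<le> card F \<longrightarrow> F \<odot> {g} \<inter> T \<noteq> {}"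
      and T_sparse: "\<forall>g. 2 * card (F \<odot> {g} \<inter> (N \<odot> W) \<odot> T) \<le> card F"
      by (elim exE conjE) (rule that)
    have sepT: "y = x" if "x \<in> T" "y \<in> T" "y \<in> A \<odot> {x}" for x y
      using T_sep that by simp
    have hitT: "F \<odot> {g} \<inter> T \<noteq> {}"
      if "g \<in> iv ` F \<odot> (N \<odot> (J \<odot> B0))" "2 * card (F \<odot> {g} \<inter> N \<odot> supp u) \<le> card F" for g
      using T_hit[rule_format, OF that] .
    have sparseT: "2 * card (F \<odot> {g} \<inter> (N \<odot> W) \<odot> T) \<le> card F" for g
      using T_sparse[rule_format] .
    have far: "(C \<odot> (W \<odot> {t})) \<inter> (C \<odot> (C \<odot> (W \<odot> {s}))) = {}" if "s \<in> T" "t \<in> T" "s \<noteq> t" for s t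
    proof (rule equals0I)
      fix x assume "x \<in> (C \<odot> (W \<odot> {t})) \<inter> (C \<odot> (C \<odot> (W \<odot> {s})))"
      then have x: "x \<in> C \<odot> (W \<odot> {t})" "x \<in> C \<odot> (C \<odot> (W \<odot> {s}))" by blast+
      from x(1) obtain c w where cw: "c \<in> C" "w \<in> W" "x = c \<cdot> (w \<cdot> t)"
        by (auto elim!: set_prodE)
      from x(2) obtain c1 c2 w1 where cw1: "c1 \<in> C" "c2 \<in> C" "w1 \<in> W" "x = c1 \<cdot> (c2 \<cdot> (w1 \<cdot> s))"
        by (auto elim!: set_prodE)
      note * = cw(1,2) cw1(1-3)
      have eq: "c \<cdot> (w \<cdot> t) = c1 \<cdot> (c2 \<cdot> (w1 \<cdot> s))" using cw(3) cw1(4) by simp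
      have "t = iv w \<cdot> (iv c \<cdot> (c \<cdot> (w \<cdot> t)))" by simp
      also have "\<dots> = (iv w \<cdot> (iv c \<cdot> (c1 \<cdot> (c2 \<cdot> w1)))) \<cdot> s" by (simp only: eq assoc)
      also have "\<dots> \<in> A \<odot> {s}" unfolding A_def using * by (intro set_prodI imageI) auto
      finally show False using sepT[OF that(1,2)] that(3) by simp
    qed
    have sepW: "(C \<odot> (W \<odot> {s})) \<inter> (C \<odot> (W \<odot> {t})) = {}" if "s \<in> T" "t \<in> T" "s \<noteq> t" for s t
    proof -
      have "(C \<odot> (W \<odot> {t})) \<inter> (C \<odot> (W \<odot> {s})) \<subseteq> (C \<odot> (W \<odot> {t})) \<inter> (C \<odot> (C \<odot> (W \<odot> {s})))"
        by (rule Int_mono[OF order_refl subset_set_prod[OF fin(6)]])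
      also have "\<dots> = {}" by (rule far[OF that])
      finally show ?thesis by (simp add: Int_commute)
    qed
    define T0 where "T0 = {t \<in> T. (C \<odot> (W \<odot> {t})) \<inter> (C \<odot> (C \<odot> B0)) \<noteq> {}}"
    define v where "v = u \<union> (\<Union>t\<in>T0. shift t p)"
    have supp_v: "supp v = supp u \<union> W \<odot> T0" by (simp add: v_def supp_translates W_def)
    have glued_v: "glued C \<G> v"
      unfolding v_def
    proof (rule glued_Un[OF \<G>'_glued[OF u] glued_translates[OF p]])
      show "shift t p \<in> \<G>" for t by (rule flexD(4)[OF p])
      show "finite T0" using T by (simp add: T0_def)
      show "(C \<odot> (supp p \<odot> {s})) \<inter> (C \<odot> (supp p \<odot> {t})) = {}" if "s \<in> T0" "t \<in> T0" "s \<noteq> t" for s t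
        using sepW[of s t] that by (simp add: T0_def W_def)
      show "(C \<odot> supp u) \<inter> (C \<odot> supp (\<Union>t\<in>T0. shift t p)) = {}"
      proof (rule equals0I)
        fix x assume "x \<in> (C \<odot> supp u) \<inter> (C \<odot> supp (\<Union>t\<in>T0. shift t p))"
        then have x: "x \<in> C \<odot> supp u" "x \<in> C \<odot> (W \<odot> T0)" by (simp_all add: supp_translates W_def)
        from x(1) obtain c y where cy: "c \<in> C" "y \<in> supp u" "x = c \<cdot> y"
          by (auto elim!: set_prodE)
        from x(2) obtain c1 w t where cwt: "c1 \<in> C" "w \<in> W" "t \<in> T0" "x = c1 \<cdot> (w \<cdot> t)"
          by (auto elim!: set_prodE)
        note * = cy(1,2) cwt(1-3)
        have eq: "c1 \<cdot> (w \<cdot> t) = c \<cdot> y" using cy(3) cwt(4) by simp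
        have "t = iv w \<cdot> (iv c1 \<cdot> (c1 \<cdot> (w \<cdot> t)))" by simp
        also have "\<dots> = (iv w \<cdot> (iv c1 \<cdot> c)) \<cdot> y" by (simp only: eq assoc)
        also have "\<dots> \<in> N \<odot> supp u" unfolding N_def using * by (intro set_prodI insertI2 imageI) auto
        finally show False using T(2) *(5) by (auto simp: T0_def)
      qed
    qed
    obtain q where q: "q \<in> \<G>" "v \<subseteq> q" "B0 \<subseteq> supp q" and "supp q \<subseteq> C \<odot> (B0 \<union> supp v)"
      using flexD(5)[OF glued_v finB0] by blast
    then have supp_q: "supp q \<subseteq> C \<odot> (B0 \<union> W \<odot> T0)" by (auto simp: supp_v B0_def Un_assoc)
    have "T0 \<subseteq> iv ` W \<odot> (iv ` C \<odot> (C \<odot> C)) \<odot> B0"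
    proof
      fix t assume "t \<in> T0"
      then have "(C \<odot> (W \<odot> {t})) \<inter> (C \<odot> (C \<odot> B0)) \<noteq> {}" by (simp add: T0_def)
      then obtain c w c1 c2 b where *: "c \<in> C" "w \<in> W" "c1 \<in> C" "c2 \<in> C" "b \<in> B0"
        and eq: "c \<cdot> (w \<cdot> t) = c1 \<cdot> (c2 \<cdot> b)"
        by (rule set_prod_meetE) (auto elim!: set_prodE)
      have "t = iv w \<cdot> (iv c \<cdot> (c \<cdot> (w \<cdot> t)))" by simp
      also have "\<dots> = (iv w \<cdot> (iv c \<cdot> (c1 \<cdot> c2))) \<cdot> b" by (simp only: eq assoc)
      also have "\<dots> \<in> iv ` W \<odot> (iv ` C \<odot> (C \<odot> C)) \<odot> B0"
        using * by (intro set_prodI imageI) auto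
      finally show "t \<in> iv ` W \<odot> (iv ` C \<odot> (C \<odot> C)) \<odot> B0" .
    qed
    then have "C \<odot> (W \<odot> T0) \<subseteq> C \<odot> (W \<odot> (iv ` W \<odot> (iv ` C \<odot> (C \<odot> C)) \<odot> B0))"
      by (intro set_prod_mono order_refl)
    also have "\<dots> \<subseteq> J \<odot> B0"
      using set_prod_mono[of "C \<odot> (W \<odot> (iv ` W \<odot> (iv ` C \<odot> (C \<odot> C))))" J B0 B0]
      by (simp add: J_def set_prod_assoc)
    finally have supp_q_J: "supp q \<subseteq> J \<odot> B0"
      using supp_q set_prod_mono[of C J B0 B0] by (auto simp: set_prod_Un_right J_def)
    define R where "R = {t \<in> T - T0. t \<in> F \<odot> (iv ` F \<odot> (N \<odot> supp q))}"
    define q' where "q' = q \<union> (\<Union>t\<in>R. shift t p)"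
    have supp_q': "supp q' = supp q \<union> W \<odot> R" by (simp add: q'_def supp_translates W_def)
    have glued_q': "glued C \<G> q'"
      unfolding q'_def
    proof (rule glued_Un[OF glued_single[OF q(1)] glued_translates[OF p]])
      show "shift t p \<in> \<G>" for t by (rule flexD(4)[OF p])
      show "finite R" using T by (simp add: R_def)
      show "(C \<odot> (supp p \<odot> {s})) \<inter> (C \<odot> (supp p \<odot> {t})) = {}" if "s \<in> R" "t \<in> R" "s \<noteq> t" for s t
        using sepW[of s t] that by (simp add: R_def W_def)
      show "(C \<odot> supp q) \<inter> (C \<odot> supp (\<Union>t\<in>R. shift t p)) = {}"
      proof (rule equals0I)
        fix x assume "x \<in> (C \<odot> supp q) \<inter> (C \<odot> supp (\<Union>t\<in>R. shift t p))"
        then have x: "x \<in> C \<odot> supp q" "x \<in> C \<odot> (W \<odot> R)" by (simp_all add: supp_translates W_def)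
        moreover have "C \<odot> (W \<odot> R) = (\<Union>t\<in>R. C \<odot> (W \<odot> {t}))"
          by (subst set_prod_eq_UN) (simp only: set_prod_UN_right)
        ultimately obtain t where t: "t \<in> R" "x \<in> C \<odot> (W \<odot> {t})" "x \<in> C \<odot> supp q" by blast
        then have "x \<in> C \<odot> (C \<odot> (B0 \<union> W \<odot> T0))"
          using set_prod_mono[OF order_refl supp_q, of C] by blast
        moreover have "C \<odot> (C \<odot> (B0 \<union> W \<odot> T0)) = C \<odot> (C \<odot> B0) \<union> (\<Union>t\<in>T0. C \<odot> (C \<odot> (W \<odot> {t})))"
          by (subst set_prod_eq_UN[of W T0]) (simp only: set_prod_Un_right set_prod_UN_right)
        ultimately consider "x \<in> C \<odot> (C \<odot> B0)" | s where "s \<in> T0" "x \<in> C \<odot> (C \<odot> (W \<odot> {s}))"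
          by blast
        then show False
        proof cases
          case 1
          then show False using t by (auto simp: T0_def R_def)
        next
          case 2
          then show False using far[of s t] t by (auto simp: T0_def R_def)
        qed
      qed
    qed
    have "met q' g \<or> 2 * card (F \<odot> {g} \<inter> N \<odot> supp q') \<le> card F" for g
    proof (cases "F \<odot> {g} \<inter> N \<odot> supp q = {}")
      case True
      then have "F \<odot> {g} \<inter> N \<odot> supp q' \<subseteq> F \<odot> {g} \<inter> N \<odot> (W \<odot> R)"
        by (auto simp: supp_q' set_prod_Un_right)
      also have "\<dots> \<subseteq> F \<odot> {g} \<inter> (N \<odot> W) \<odot> T"
        using set_prod_mono[of "N \<odot> W" "N \<odot> W" R T] by (auto simp: R_def set_prod_assoc)
      finally have "card (F \<odot> {g} \<inter> N \<odot> supp q') \<le> card (F \<odot> {g} \<inter> (N \<odot> W) \<odot> T)"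
        using F(1) by (intro card_mono) auto
      then show ?thesis using sparseT[of g] by linarith
    next
      case False
      obtain f n y where fny: "f \<in> F" "n \<in> N" "y \<in> supp q" "f \<cdot> g = n \<cdot> y"
        by (rule set_prod_meetE[OF False]) auto
      have "g = iv f \<cdot> (f \<cdot> g)" by simp
      also have "\<dots> = iv f \<cdot> (n \<cdot> y)" by (simp only: fny(4))
      also have "\<dots> \<in> iv ` F \<odot> (N \<odot> supp q)" using fny by (intro set_prodI imageI) auto
      finally have g: "g \<in> iv ` F \<odot> (N \<odot> supp q)" .
      also have "\<dots> \<subseteq> iv ` F \<odot> (N \<odot> (J \<odot> B0))" by (intro set_prod_mono order_refl supp_q_J)
      finally have gH: "g \<in> iv ` F \<odot> (N \<odot> (J \<odot> B0))" .
      have "u \<subseteq> q'" using q(2) by (auto simp: v_def q'_def)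
      have "met q' g"
      proof (cases "met u g")
        case True
        then show ?thesis using \<open>u \<subseteq> q'\<close> met_mono by blast
      next
        case False
        then have "2 * card (F \<odot> {g} \<inter> N \<odot> supp u) \<le> card F" using u by (auto simp: \<G>'_def)
        then obtain s where s: "s \<in> F" "s \<cdot> g \<in> T" using hitT[OF gH] by (auto simp: set_prod_singleton)
        have "s \<cdot> g \<in> F \<odot> (iv ` F \<odot> (N \<odot> supp q))" using s(1) g by (rule set_prodI)
        then have "shift (s \<cdot> g) p \<subseteq> q'"
          using s(2) q(2) by (auto simp: q'_def v_def R_def)
        then show ?thesis using s(1) by (auto simp: met_def)
      qed
      then show ?thesis ..
    qed
    then have "q' \<in> \<G>'" using glued_q' by (auto simp: \<G>'_def)
    moreover have "u \<subseteq> q'" using q(2) by (auto simp: v_def q'_def)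
    moreover have "B \<subseteq> supp q'" using q(3) by (auto simp: B0_def supp_q')
    moreover have "supp q' \<subseteq> C' \<odot> (B \<union> supp u)"
    proof -
      have "R \<subseteq> F \<odot> (iv ` F \<odot> (N \<odot> supp q))" by (simp add: R_def subset_iff)
      also have "\<dots> \<subseteq> F \<odot> (iv ` F \<odot> (N \<odot> (J \<odot> B0)))" by (intro set_prod_mono order_refl supp_q_J)
      finally have "W \<odot> R \<subseteq> W \<odot> (F \<odot> (iv ` F \<odot> (N \<odot> (J \<odot> B0))))"
        by (intro set_prod_mono order_refl)
      also have "\<dots> \<subseteq> C' \<odot> B0"
        using set_prod_mono[of "W \<odot> (F \<odot> (iv ` F \<odot> (N \<odot> J)))" C' B0 B0]
        by (simp add: C'_def set_prod_assoc)
      finally have "W \<odot> R \<subseteq> C' \<odot> B0" .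
      moreover have "J \<odot> B0 \<subseteq> C' \<odot> B0" by (intro set_prod_mono order_refl) (auto simp: C'_def)
      ultimately show ?thesis using supp_q_J by (auto simp: supp_q' B0_def)
    qed
    ultimately show ?thesis by blast
  qed
  have "finite C'" using fin F by (auto simp: C'_def J_def)
  have flex': "flexible \<G>' C'"
    unfolding flexible_def
  proof (intro conjI ballI allI impI)
    show "finite C'" by fact
    show "e \<in> C'" using \<open>C \<subseteq> C'\<close> fin(6) by blast
    show "finite q" "shift t q \<in> \<G>'" if "q \<in> \<G>'" for q t
      using finite_glued[OF \<G>'_glued[OF that] flexD(3)] shift_\<G>'[OF that] by auto
    show "\<exists>q\<in>\<G>'. u \<subseteq> q \<and> B \<subseteq> supp q \<and> supp q \<subseteq> C' \<odot> (B \<union> supp u)"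
      if "glued C' \<G>' u" "finite B" for u B
      by (rule extend[OF closed[OF that(1)] that(2)])
  qed
  \<comment> \<open>A member of \<open>\<G>'\<close> that covers \<open>F\<close> contains a translate of \<open>p\<close>; translate it back.\<close>
  have "glued C' \<G>' {}" unfolding glued_def by (intro exI[of _ "{}"]) auto
  then obtain q where q: "q \<in> \<G>'" "F \<odot> {e} \<subseteq> supp q"
    using flexibleD(5)[OF flex', of "{}" "F \<odot> {e}"] F(1) by auto
  then obtain s where "shift s p \<subseteq> q" using \<G>'_met[OF q] by (auto simp: met_def)
  from shift_mono[OF this, of "iv s"] have "p \<subseteq> shift (iv s) q" by (simp add: shift_shift)
  with shift_\<G>'[OF q(1), of "iv s"] have ex: "\<exists>q\<in>\<G>'. p \<subseteq> q" by (rule bexI[rotated])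
  show ?thesis
  proof (rule that[of F \<G>' C'])
    show "\<exists>s\<in>F. shift (s \<cdot> g) p \<subseteq> q" if "q \<in> \<G>'" "F \<odot> {g} \<subseteq> supp q" for q g
      using \<G>'_met[OF that] by (simp add: met_def)
  qed (fact F flex' \<open>C \<subseteq> C'\<close> \<open>iv ` F \<subseteq> C'\<close> ex \<G>'_glued)+
qed

text \<open>
  The clause on \<open>iv ` F\<close> ensures that a translate of \<open>F\<close> inside a \<open>C\<close>-gluing lies inside one of its pieces,
  which is why the property survives all later steps.
\<close>

definition recurs :: "'a set \<Rightarrow> ('a, 'b) pattern \<Rightarrow> ('a, 'b) pattern set \<Rightarrow> 'a set \<Rightarrow> bool"
  where "recurs F p \<G> C \<longleftrightarrow> F \<noteq> {} \<and> iv ` F \<subseteq> C \<and>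
    (\<forall>q\<in>\<G>. \<forall>g. F \<odot> {g} \<subseteq> supp q \<longrightarrow> (\<exists>s\<in>F. shift (s \<cdot> g) p \<subseteq> q))"

lemma recurs_glued:
  assumes "recurs F p \<G> C" "C \<subseteq> C'" "\<And>q. q \<in> \<G>' \<Longrightarrow> glued C \<G> q"
  shows "recurs F p \<G>' C'"
  unfolding recurs_def
proof (intro conjI ballI allI impI)
  show "F \<noteq> {}" "iv ` F \<subseteq> C'" using assms(1,2) by (auto simp: recurs_def)
  fix u g assume u: "u \<in> \<G>'" "F \<odot> {g} \<subseteq> supp u"
  obtain \<F> where \<F>: "\<F> \<subseteq> \<G>" "u = \<Union>\<F>"
    and sep: "\<And>a b. a \<in> \<F> \<Longrightarrow> b \<in> \<F> \<Longrightarrow> a \<noteq> b \<Longrightarrow> (C \<odot> supp a) \<inter> (C \<odot> supp b) = {}"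
    using assms(3)[OF u(1)] unfolding glued_def by blast
  have piece: "\<exists>a\<in>\<F>. f \<cdot> g \<in> supp a" if "f \<in> F" for f
  proof -
    have "f \<cdot> g \<in> supp u" using u(2) that by (auto simp: set_prod_singleton)
    then show ?thesis by (auto simp: \<F>(2) supp_Union)
  qed
  have g_in: "g \<in> C \<odot> supp a" if "f \<in> F" "f \<cdot> g \<in> supp a" for f a
  proof -
    have "iv f \<cdot> (f \<cdot> g) \<in> C \<odot> supp a"
      using assms(1) that by (intro set_prodI) (auto simp: recurs_def)
    then show ?thesis by simp
  qed
  obtain f where f: "f \<in> F" using assms(1) by (auto simp: recurs_def)
  then obtain a where a: "a \<in> \<F>" "f \<cdot> g \<in> supp a" using piece by blast
  have "f' \<cdot> g \<in> supp a" if f': "f' \<in> F" for f'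
  proof -
    obtain b where b: "b \<in> \<F>" "f' \<cdot> g \<in> supp b" using piece[OF f'] by blast
    have "a = b" using sep[OF a(1) b(1)] g_in[OF f a(2)] g_in[OF f' b(2)] by blast
    then show ?thesis using b(2) by simp
  qed
  then have "F \<odot> {g} \<subseteq> supp a" by (auto simp: set_prod_singleton)
  then obtain s where "s \<in> F" "shift (s \<cdot> g) p \<subseteq> a"
    using assms(1) a(1) \<F>(1) unfolding recurs_def by blast
  then show "\<exists>s\<in>F. shift (s \<cdot> g) p \<subseteq> u" using a(1) \<F>(2) by blast
qed

section \<open>Colouring against fixed points\<close>

text \<open>
  Labels are pairs of an index and a colour, and the colours with index \<open>k\<close> have to form a proper
  3-colouring of the graph with edges between \<open>x\<close> and \<open>\<gamma> x\<close>.  For \<open>\<gamma> = e\<close> the graph would consist of loops,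
  and only the existence and uniqueness of the colours is asked for.
\<close>

definition coloured :: "'a \<Rightarrow> nat \<Rightarrow> ('a, nat \<times> nat) pattern \<Rightarrow> bool"
  where "coloured \<gamma> k q \<longleftrightarrow> (\<forall>x\<in>supp q. \<exists>c<3. (x, k, c) \<in> q) \<and>
    (\<forall>x c d. (x, k, c) \<in> q \<longrightarrow> (x, k, d) \<in> q \<longrightarrow> c = d) \<and>
    (\<gamma> \<noteq> e \<longrightarrow> (\<forall>x c. (x, k, c) \<in> q \<longrightarrow> (\<gamma> \<cdot> x, k, c) \<notin> q))"

lemma colouredD:
  assumes "coloured \<gamma> k q"
  shows "x \<in> supp q \<Longrightarrow> \<exists>c<3. (x, k, c) \<in> q"
    and "(x, k, c) \<in> q \<Longrightarrow> (x, k, d) \<in> q \<Longrightarrow> c = d"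
    and "\<gamma> \<noteq> e \<Longrightarrow> (x, k, c) \<in> q \<Longrightarrow> (\<gamma> \<cdot> x, k, c) \<notin> q"
  using assms unfolding coloured_def by (simp, metis, simp)

text \<open>
  If \<open>C\<close> contains \<open>e\<close> and \<open>\<gamma>\<close>, then no edge connects two pieces of a \<open>C\<close>-gluing.
\<close>

lemma coloured_glued:
  assumes u: "glued C \<G> u" and C: "e \<in> C" "\<gamma> \<in> C" and col: "\<And>q. q \<in> \<G> \<Longrightarrow> coloured \<gamma> k q"
  shows "coloured \<gamma> k u"
proof -
  obtain \<F> where \<F>: "\<F> \<subseteq> \<G>" "u = \<Union>\<F>"
    and sep: "\<And>a b. a \<in> \<F> \<Longrightarrow> b \<in> \<F> \<Longrightarrow> a \<noteq> b \<Longrightarrow> (C \<odot> supp a) \<inter> (C \<odot> supp b) = {}"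
    using u unfolding glued_def by blast
  have same: "a = b" if "a \<in> \<F>" "b \<in> \<F>" "x \<in> supp a" "c \<cdot> x \<in> supp b" "c \<in> C" for a b x c
  proof -
    have "c \<cdot> x \<in> C \<odot> supp a" "e \<cdot> (c \<cdot> x) \<in> C \<odot> supp b" using that C(1) by (blast intro: set_prodI)+
    then show ?thesis using sep[OF that(1,2)] by auto
  qed
  have same': "a = b" if "a \<in> \<F>" "b \<in> \<F>" "x \<in> supp a" "x \<in> supp b" for a b x
    using same[OF that(1,2,3), of e] that C by simp
  have cF: "coloured \<gamma> k a" if "a \<in> \<F>" for a using col \<F>(1) that by blast
  show ?thesis
    unfolding coloured_def
  proof (intro conjI ballI allI impI)
    fix x assume "x \<in> supp u"
    then obtain a where a: "a \<in> \<F>" "x \<in> supp a" by (auto simp: \<F>(2) supp_Union)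
    then show "\<exists>c<3. (x, k, c) \<in> u" using colouredD(1)[OF cF[OF a(1)] a(2)] \<F>(2) by blast
  next
    fix x c d assume "(x, k, c) \<in> u" "(x, k, d) \<in> u"
    then obtain a b where ab: "a \<in> \<F>" "(x, k, c) \<in> a" "b \<in> \<F>" "(x, k, d) \<in> b" by (auto simp: \<F>(2))
    then have "a = b" using same'[OF ab(1,3) supp_memI[OF ab(2)] supp_memI[OF ab(4)]] by simp
    then show "c = d" using colouredD(2)[OF cF[OF ab(1)]] ab by simp
  next
    fix x c assume "\<gamma> \<noteq> e" "(x, k, c) \<in> u"
    show "(\<gamma> \<cdot> x, k, c) \<notin> u"
    proof
      assume "(\<gamma> \<cdot> x, k, c) \<in> u"
      then obtain a b where ab: "a \<in> \<F>" "(x, k, c) \<in> a" "b \<in> \<F>" "(\<gamma> \<cdot> x, k, c) \<in> b"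
        using \<open>(x, k, c) \<in> u\<close> by (auto simp: \<F>(2))
      then have "a = b" using same[OF ab(1,3) supp_memI[OF ab(2)] supp_memI[OF ab(4)] C(2)] by simp
      then show False using colouredD(3)[OF cF[OF ab(1)] \<open>\<gamma> \<noteq> e\<close> ab(2)] ab(4) by simp
    qed
  qed
qed

text \<open>
  The graph has degree at most 2, so with three colours a partial proper colouring can be extended
  greedily.  This is the reason why adding colours is harmless for flexibility.
\<close>

lemma three_colouring_extends:
  fixes col :: "'a \<Rightarrow> nat"
  assumes "finite D" and \<gamma>: "\<gamma> \<noteq> e"
    and "\<And>x. x \<in> A \<Longrightarrow> col x < 3" "\<And>x. x \<in> A \<Longrightarrow> \<gamma> \<cdot> x \<in> A \<Longrightarrow> col (\<gamma> \<cdot> x) \<noteq> col x"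
  shows "\<exists>col'. (\<forall>x\<in>A. col' x = col x) \<and> (\<forall>x\<in>A \<union> D. col' x < 3) \<and>
    (\<forall>x\<in>A \<union> D. \<gamma> \<cdot> x \<in> A \<union> D \<longrightarrow> col' (\<gamma> \<cdot> x) \<noteq> col' x)"
  using assms(1)
proof (induction rule: finite_induct)
  case empty
  show ?case using assms(3,4) by (intro exI[of _ col]) auto
next
  case (insert y D)
  then obtain col' where col': "\<forall>x\<in>A. col' x = col x" "\<forall>x\<in>A \<union> D. col' x < 3"
    "\<forall>x\<in>A \<union> D. \<gamma> \<cdot> x \<in> A \<union> D \<longrightarrow> col' (\<gamma> \<cdot> x) \<noteq> col' x" by blast
  show ?case
  proof (cases "y \<in> A")
    case True
    then have "A \<union> insert y D = A \<union> D" by auto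
    then show ?thesis using col' by metis
  next
    case False
    have "\<exists>c<3. c \<noteq> a \<and> c \<noteq> b" for a b :: nat
      by presburger
    then obtain c where c: "c < 3" "c \<noteq> col' (\<gamma> \<cdot> y)" "c \<noteq> col' (iv \<gamma> \<cdot> y)" by blast
    have ne: "\<gamma> \<cdot> x \<noteq> x" for x using \<gamma> right_cancel[of \<gamma> x e] by simp
    have prev: "x = iv \<gamma> \<cdot> y" if "\<gamma> \<cdot> x = y" for x using that by auto
    show ?thesis
    proof (intro exI[of _ "col'(y := c)"] conjI ballI impI)
      fix x assume x: "x \<in> A \<union> insert y D" "\<gamma> \<cdot> x \<in> A \<union> insert y D"
      show "(col'(y := c)) (\<gamma> \<cdot> x) \<noteq> (col'(y := c)) x"
      proof (cases "x = y")
        case True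
        then show ?thesis using ne[of y] c by auto
      next
        case False
        then show ?thesis using c prev[of x] col'(3) x by auto
      qed
    qed (use col' c False in auto)
  qed
qed

text \<open>
  Here \<open>u\<close> is a gluing that already carries colours with index \<open>k\<close>, and \<open>q\<close> is an extension of its other
  labels.
\<close>

lemma colour_pattern:
  assumes "finite q" and fresh: "\<And>x i c. (x, i, c) \<in> q \<Longrightarrow> i \<noteq> k"
    and u: "coloured \<gamma> k u" "supp u \<subseteq> supp q" "\<And>x i c. (x, i, c) \<in> u \<Longrightarrow> i \<noteq> k \<Longrightarrow> (x, i, c) \<in> q"
  shows "\<exists>q'. q \<subseteq> q' \<and> u \<subseteq> q' \<and> supp q' = supp q \<and> coloured \<gamma> k q' \<and> {z \<in> q'. fst (snd z) \<noteq> k} = q"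
proof -
  define col where "col x = (SOME c. (x, k, c) \<in> u)" for x
  have col: "col x = c" if "(x, k, c) \<in> u" for x c
  proof -
    have "(x, k, col x) \<in> u" unfolding col_def using that by (rule someI)
    then show ?thesis using colouredD(2)[OF u(1)] that by blast
  qed
  have col_mem: "(x, k, col x) \<in> u \<and> col x < 3" if "x \<in> supp u" for x
    using colouredD(1)[OF u(1) that] col by metis
  obtain col' where col': "\<And>x. x \<in> supp u \<Longrightarrow> col' x = col x" "\<And>x. x \<in> supp q \<Longrightarrow> col' x < 3"
    "\<And>x. \<gamma> \<noteq> e \<Longrightarrow> x \<in> supp q \<Longrightarrow> \<gamma> \<cdot> x \<in> supp q \<Longrightarrow> col' (\<gamma> \<cdot> x) \<noteq> col' x"
  proof (cases "\<gamma> = e")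
    case True
    show ?thesis by (rule that[of "\<lambda>x. if x \<in> supp u then col x else 0"]) (use True col_mem in auto)
  next
    case False
    have "col (\<gamma> \<cdot> x) \<noteq> col x" if "x \<in> supp u" "\<gamma> \<cdot> x \<in> supp u" for x
      using col_mem[OF that(1)] col_mem[OF that(2)] colouredD(3)[OF u(1) False] by metis
    then have "\<exists>col'. (\<forall>x\<in>supp u. col' x = col x) \<and> (\<forall>x\<in>supp u \<union> supp q. col' x < 3) \<and>
      (\<forall>x\<in>supp u \<union> supp q. \<gamma> \<cdot> x \<in> supp u \<union> supp q \<longrightarrow> col' (\<gamma> \<cdot> x) \<noteq> col' x)"
      using col_mem assms(1) False by (intro three_colouring_extends) auto
    then show ?thesis using that by blast
  qed
  define q' where "q' = q \<union> (\<lambda>x. (x, k, col' x)) ` supp q"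
  have mem: "(x, k, c) \<in> q' \<longleftrightarrow> x \<in> supp q \<and> c = col' x" for x c
    using fresh by (auto simp: q'_def)
  have supp_q': "supp q' = supp q" by (force simp: q'_def supp_def)
  show ?thesis
  proof (intro exI[of _ q'] conjI)
    show "q \<subseteq> q'" by (auto simp: q'_def)
    show "u \<subseteq> q'"
    proof
      fix z assume z: "z \<in> u"
      obtain x i c where xic: "z = (x, i, c)" by (cases z)
      show "z \<in> q'"
      proof (cases "i = k")
        case True
        then have xkc: "(x, k, c) \<in> u" using z xic by simp
        have "x \<in> supp u" "col x = c" using supp_memI[OF xkc] col[OF xkc] .
        then have "(x, k, c) \<in> q'" using u(2) col'(1) by (auto simp: mem)
        then show ?thesis using True xic by simp
      next
        case False
        then show ?thesis using u(3)[of x i c] z xic by (simp add: q'_def)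
      qed
    qed
    show "supp q' = supp q" by (rule supp_q')
    show "coloured \<gamma> k q'"
      unfolding coloured_def mem supp_q' using col'(2) col'(3)[THEN not_sym] by auto
    have "(x, k, c) \<notin> q" for x c using fresh by blast
    then show "{z \<in> q'. fst (snd z) \<noteq> k} = q" by (auto simp: q'_def)
  qed
qed

text \<open>
  Each translation \<open>\<gamma>\<close> needs its own colours, and its edges have to be controlled by \<open>C\<close>.  As \<open>C\<close> is finite,
  the colours can only be introduced one index at a time.
\<close>

lemma add_colour:
  assumes flex: "flexible \<G> C" and fresh: "\<And>q x i c. q \<in> \<G> \<Longrightarrow> (x, i, c) \<in> q \<Longrightarrow> i \<noteq> k"
  obtains \<G>' where "flexible \<G>' (insert \<gamma> C)" "\<And>q. q \<in> \<G>' \<Longrightarrow> coloured \<gamma> k q"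
    "\<And>q'. q' \<in> \<G>' \<Longrightarrow> \<exists>q\<in>\<G>. supp q = supp q' \<and> q = {z \<in> q'. fst (snd z) \<noteq> k}"
    "\<And>q. q \<in> \<G> \<Longrightarrow> \<exists>q'\<in>\<G>'. q \<subseteq> q'"
proof -
  note flexD = flexibleD[OF flex]
  define old where "old q = {z \<in> q. fst (snd z) \<noteq> k}" for q :: "('a, nat \<times> nat) pattern"
  define \<G>' where "\<G>' = {q. coloured \<gamma> k q \<and> old q \<in> \<G> \<and> supp (old q) = supp q}"
  have old_sub: "old q \<subseteq> q" for q by (auto simp: old_def)
  have finite_\<G>': "finite q" if "q \<in> \<G>'" for q
  proof -
    have "(x, i, c) \<in> old q \<union> supp q \<times> {k} \<times> {..<3}" if mem: "(x, i, c) \<in> q" for x i c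
    proof (cases "i = k")
      case True
      have "x \<in> supp q" using mem by (rule supp_memI)
      have q: "coloured \<gamma> k q" using \<open>q \<in> \<G>'\<close> by (simp add: \<G>'_def)
      obtain d where d: "d < 3" "(x, k, d) \<in> q" using colouredD(1)[OF q \<open>x \<in> supp q\<close>] by blast
      moreover have "d = c" using colouredD(2)[OF q d(2)] mem True by simp
      ultimately show ?thesis using True \<open>x \<in> supp q\<close> by simp
    qed (use mem in \<open>auto simp: old_def\<close>)
    then have "q \<subseteq> old q \<union> supp q \<times> {k} \<times> {..<3}" by auto
    moreover have "finite (old q)" "finite (supp q)"
      using that flexD(3)[of "old q"] finite_supp[of "old q"] by (auto simp: \<G>'_def)
    ultimately show ?thesis by (meson finite_SigmaI finite_UnI finite_lessThan finite.emptyI finite_insert finite_subset)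
  qed
  have shift_\<G>': "shift t q \<in> \<G>'" if "q \<in> \<G>'" for t q
  proof -
    have "old (shift t q) = shift t (old q)"
      by (auto simp: old_def mem_shift)
    moreover have "coloured \<gamma> k (shift t q)"
    proof -
      have q: "coloured \<gamma> k q" using that by (simp add: \<G>'_def)
      have "x \<cdot> iv t \<in> supp q" if "x \<in> supp (shift t q)" for x
        using that by (auto simp: supp_shift set_prod_singleton assoc)
      then show ?thesis
        unfolding coloured_def mem_shift assoc by (intro conjI ballI allI impI colouredD[OF q])
    qed
    ultimately show ?thesis using that flexD(4) by (simp add: \<G>'_def supp_shift)
  qed
  have extend: "\<exists>q\<in>\<G>'. u \<subseteq> q \<and> B \<subseteq> supp q \<and> supp q \<subseteq> insert \<gamma> C \<odot> (B \<union> supp u)"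
    if u: "glued (insert \<gamma> C) \<G>' u" and B: "finite B" for u B
  proof -
    have col_u: "coloured \<gamma> k u"
      using u by (rule coloured_glued) (use flexD(2) in \<open>auto simp: \<G>'_def\<close>)
    obtain \<F> where \<F>: "\<F> \<subseteq> \<G>'" "finite \<F>" "u = \<Union>\<F>"
      and sep: "\<And>a b. a \<in> \<F> \<Longrightarrow> b \<in> \<F> \<Longrightarrow> a \<noteq> b \<Longrightarrow> (insert \<gamma> C \<odot> supp a) \<inter> (insert \<gamma> C \<odot> supp b) = {}"
      using u unfolding glued_def by blast
    have supp_old: "supp (old a) = supp a" "old a \<in> \<G>" if "a \<in> \<F>" for a
      using that \<F>(1) by (auto simp: \<G>'_def)
    have "old u = \<Union>(old ` \<F>)" by (auto simp: old_def \<F>(3))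
    have "glued C \<G> (old u)"
      unfolding glued_def
    proof (intro exI[of _ "old ` \<F>"] conjI ballI impI)
      fix a b assume "a \<in> old ` \<F>" "b \<in> old ` \<F>" "a \<noteq> b"
      then obtain a' b' where ab: "a' \<in> \<F>" "b' \<in> \<F>" "a' \<noteq> b'" "a = old a'" "b = old b'" by blast
      then have "C \<odot> supp a \<subseteq> insert \<gamma> C \<odot> supp a'" "C \<odot> supp b \<subseteq> insert \<gamma> C \<odot> supp b'"
        by (auto simp: supp_old intro: set_prod_mono[THEN subsetD, rotated 2])
      then show "(C \<odot> supp a) \<inter> (C \<odot> supp b) = {}" using sep[OF ab(1-3)] by blast
    qed (use \<F> supp_old \<open>old u = \<Union>(old ` \<F>)\<close> in auto)
    then obtain q where q: "q \<in> \<G>" "old u \<subseteq> q" "B \<subseteq> supp q" "supp q \<subseteq> C \<odot> (B \<union> supp (old u))"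
      using flexD(5) B by blast
    have "supp (old u) = (\<Union>a\<in>\<F>. supp (old a))"
      unfolding \<open>old u = \<Union>(old ` \<F>)\<close> supp_Union by simp
    also have "\<dots> = (\<Union>a\<in>\<F>. supp a)" by (intro SUP_cong refl) (simp add: supp_old)
    also have "\<dots> = supp u" by (simp add: \<F>(3) supp_Union)
    finally have supp_u: "supp (old u) = supp u" .
    have "\<exists>q'. q \<subseteq> q' \<and> u \<subseteq> q' \<and> supp q' = supp q \<and> coloured \<gamma> k q' \<and> {z \<in> q'. fst (snd z) \<noteq> k} = q"
    proof (rule colour_pattern[OF flexD(3)[OF q(1)] fresh[OF q(1)] col_u])
      show "supp u \<subseteq> supp q" using supp_mono[OF q(2)] by (simp add: supp_u)
      show "(x, i, c) \<in> q" if "(x, i, c) \<in> u" "i \<noteq> k" for x i c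
        using that q(2) by (auto simp: old_def)
    qed
    then obtain q' where q': "q \<subseteq> q'" "u \<subseteq> q'" "supp q' = supp q" "coloured \<gamma> k q'"
      "{z \<in> q'. fst (snd z) \<noteq> k} = q" by blast
    have "q' \<in> \<G>'" using q' q(1) by (simp add: \<G>'_def old_def)
    moreover have "supp q' \<subseteq> insert \<gamma> C \<odot> (B \<union> supp u)"
      using q(4) set_prod_mono[of C "insert \<gamma> C" "B \<union> supp u" "B \<union> supp u"] by (auto simp: supp_u q'(3))
    ultimately show ?thesis using q' q(3) by blast
  qed
  have flex': "flexible \<G>' (insert \<gamma> C)"
    unfolding flexible_def
  proof (intro conjI ballI allI impI)
    show "finite (insert \<gamma> C)" "e \<in> insert \<gamma> C" using flexD(1,2) by auto
  qed (fact finite_\<G>' shift_\<G>' extend)+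
  show ?thesis
  proof (rule that[OF flex'])
    show "coloured \<gamma> k q" if "q \<in> \<G>'" for q using that by (simp add: \<G>'_def)
    show "\<exists>q\<in>\<G>. supp q = supp q' \<and> q = {z \<in> q'. fst (snd z) \<noteq> k}" if "q' \<in> \<G>'" for q'
      using that by (auto simp: \<G>'_def old_def)
    show "\<exists>q'\<in>\<G>'. q \<subseteq> q'" if "q \<in> \<G>" for q
    proof -
      have "\<exists>q'. q \<subseteq> q' \<and> {} \<subseteq> q' \<and> supp q' = supp q \<and> coloured \<gamma> k q' \<and> {z \<in> q'. fst (snd z) \<noteq> k} = q"
        by (rule colour_pattern[OF flexD(3)[OF that] fresh[OF that]]) (simp_all add: coloured_def supp_def)
      then obtain q' where "q \<subseteq> q'" "supp q' = supp q" "coloured \<gamma> k q'" "{z \<in> q'. fst (snd z) \<noteq> k} = q"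
        by blast
      then show ?thesis using that by (intro bexI[of _ q']) (auto simp: \<G>'_def old_def)
    qed
  qed
qed

section \<open>The recurrent colouring\<close>

definition stage :: "(nat \<Rightarrow> 'a) \<Rightarrow> nat \<Rightarrow> ('a, nat \<times> nat) pattern set \<Rightarrow> 'a set \<Rightarrow> ('a, nat \<times> nat) pattern \<Rightarrow> bool"
  where "stage \<gamma> k \<G> C p \<longleftrightarrow> flexible \<G> C \<and> p \<in> \<G> \<and>
    (\<forall>q\<in>\<G>. \<forall>x i c. (x, i, c) \<in> q \<longrightarrow> i \<le> k) \<and>
    (\<forall>i\<le>k. \<gamma> i \<in> C \<and> (\<forall>q\<in>\<G>. coloured (\<gamma> i) i q))"

text \<open>
  The index \<open>0\<close> belongs to the trivial translation and has the constant colour \<open>0\<close>.  It only serves to give patterns a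
  support before the first proper colouring is introduced.
\<close>

lemma stage_0:
  assumes "\<gamma> 0 = e"
  shows "\<exists>\<G>. stage \<gamma> 0 \<G> {e} {}"
proof
  define \<G> :: "('a, nat \<times> nat) pattern set" where "\<G> = {B \<times> {(0, 0)} |B. finite B}"
  have supp: "supp (B \<times> {(0::nat, 0::nat)}) = B" for B :: "'a set" by (force simp: supp_def)
  have "flexible \<G> {e}"
    unfolding flexible_def
  proof (intro conjI ballI allI impI)
    fix q t assume "q \<in> \<G>"
    then obtain B where B: "finite B" "q = B \<times> {(0, 0)}" by (auto simp: \<G>_def)
    then show "finite q" by simp
    have "shift t q = (B \<odot> {t}) \<times> {(0, 0)}" unfolding shift_def set_prod_singleton B(2) by force
    then show "shift t q \<in> \<G>" using B(1) by (auto simp: \<G>_def)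
  next
    fix u and B :: "'a set" assume u: "glued {e} \<G> u" and B: "finite B"
    have fin: "finite u" using u by (rule finite_glued) (auto simp: \<G>_def)
    have "z \<in> UNIV \<times> {(0, 0)}" if "z \<in> u" for z
    proof -
      obtain a where "a \<in> \<G>" "z \<in> a" using u \<open>z \<in> u\<close> unfolding glued_def by auto
      then show ?thesis by (auto simp: \<G>_def)
    qed
    then have "u \<subseteq> supp u \<times> {(0, 0)}" by (force simp: supp_def)
    then have "u \<subseteq> (B \<union> supp u) \<times> {(0, 0)}" by auto
    moreover have "finite (B \<union> supp u)" using B fin by simp
    then have "(B \<union> supp u) \<times> {(0, 0)} \<in> \<G>" unfolding \<G>_def by blast
    moreover have "B \<union> supp u \<subseteq> {e} \<odot> (B \<union> supp u)" by (rule subset_set_prod) simp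
    ultimately show "\<exists>q\<in>\<G>. u \<subseteq> q \<and> B \<subseteq> supp q \<and> supp q \<subseteq> {e} \<odot> (B \<union> supp u)"
      by (intro bexI[of _ "(B \<union> supp u) \<times> {(0, 0)}"]) (simp_all only: supp, simp)
  qed auto
  moreover have "coloured e 0 q" if q: "q \<in> \<G>" for q
  proof -
    obtain B where B: "q = B \<times> {(0, 0)}" using q by (auto simp: \<G>_def)
    show ?thesis unfolding B coloured_def supp by (intro conjI ballI allI impI) auto
  qed
  moreover have "{} \<in> \<G>" unfolding \<G>_def by blast
  moreover have "i \<le> 0" if "q \<in> \<G>" "(x, i, c) \<in> q" for q x i c using that by (auto simp: \<G>_def)
  ultimately show "stage \<gamma> 0 \<G> {e} {}"
    unfolding stage_def using assms by auto
qed

lemma stage_Suc: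
  assumes st: "stage \<gamma> k \<G> C p" and S: "infinite S" and B: "finite B"
  obtains \<G>' C' p' F where "stage \<gamma> (Suc k) \<G>' C' p'" "p \<subseteq> p'" "B \<subseteq> supp p'"
    "finite F" "F \<subseteq> S" "recurs F p \<G>' C'"
    "\<And>F0 p0. recurs F0 p0 \<G> C \<Longrightarrow> recurs F0 p0 \<G>' C'"
proof -
  have flex: "flexible \<G> C" and p: "p \<in> \<G>"
    and ind: "\<And>q x i c. q \<in> \<G> \<Longrightarrow> (x, i, c) \<in> q \<Longrightarrow> i \<le> k"
    and col: "\<And>i. i \<le> k \<Longrightarrow> \<gamma> i \<in> C" "\<And>i q. i \<le> k \<Longrightarrow> q \<in> \<G> \<Longrightarrow> coloured (\<gamma> i) i q"
    using st unfolding stage_def by auto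
  have fresh: "i \<noteq> Suc k" if "q \<in> \<G>" "(x, i, c) \<in> q" for q x i c
    using ind[OF that] by simp
  define C1 where "C1 = insert (\<gamma> (Suc k)) C"
  obtain \<G>1 where flex1: "flexible \<G>1 C1" and col1: "\<And>q. q \<in> \<G>1 \<Longrightarrow> coloured (\<gamma> (Suc k)) (Suc k) q"
    and old: "\<And>q'. q' \<in> \<G>1 \<Longrightarrow> \<exists>q\<in>\<G>. supp q = supp q' \<and> q = {z \<in> q'. fst (snd z) \<noteq> Suc k}"
    and new: "\<And>q. q \<in> \<G> \<Longrightarrow> \<exists>q'\<in>\<G>1. q \<subseteq> q'"
    by (rule add_colour[OF flex, where k = "Suc k" and \<gamma> = "\<gamma> (Suc k)", folded C1_def])
      (rule fresh, assumption+, rule that)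
  have ind1: "i \<le> Suc k" if q': "q' \<in> \<G>1" "(x, i, c) \<in> q'" for q' x i c
  proof (cases "i = Suc k")
    case False
    then have "(x, i, c) \<in> {z \<in> q'. fst (snd z) \<noteq> Suc k}" using q' by simp
    then show ?thesis using old[OF q'(1)] ind by fastforce
  qed simp
  have col1': "coloured (\<gamma> i) i q'" if i: "i \<le> Suc k" and q': "q' \<in> \<G>1" for i q'
  proof (cases "i = Suc k")
    case False
    then have "i \<le> k" using i by simp
    obtain q where q: "q \<in> \<G>" "supp q = supp q'" "q = {z \<in> q'. fst (snd z) \<noteq> Suc k}"
      using old[OF q'] by blast
    have "coloured (\<gamma> i) i q" by (rule col(2)[OF \<open>i \<le> k\<close> q(1)])
    moreover have "(x, i, c) \<in> q \<longleftrightarrow> (x, i, c) \<in> q'" for x c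
      unfolding q(3) using False by simp
    ultimately show ?thesis unfolding coloured_def q(2) by simp
  qed (use col1 q' in simp)
  obtain p1 where p1: "p1 \<in> \<G>1" "p \<subseteq> p1" using new[OF p] by blast
  obtain F \<G>2 C2 where F: "finite F" "F \<subseteq> S" and flex2: "flexible \<G>2 C2" and C2: "C1 \<subseteq> C2" "iv ` F \<subseteq> C2"
    and glued2: "\<And>q. q \<in> \<G>2 \<Longrightarrow> glued C1 \<G>1 q"
    and rec2: "\<And>q g. q \<in> \<G>2 \<Longrightarrow> F \<odot> {g} \<subseteq> supp q \<Longrightarrow> \<exists>s\<in>F. shift (s \<cdot> g) p1 \<subseteq> q"
    and ex2: "\<exists>q\<in>\<G>2. p1 \<subseteq> q"
    by (rule force_recurrence[OF flex1 p1(1) S]) (rule that)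
  obtain q where q: "q \<in> \<G>2" "p1 \<subseteq> q" using ex2 by blast
  obtain p' where p': "p' \<in> \<G>2" "q \<subseteq> p'" "B \<subseteq> supp p'"
    using flexibleD(5)[OF flex2 glued_single[OF q(1)] B] by blast
  have stage': "stage \<gamma> (Suc k) \<G>2 C2 p'"
    unfolding stage_def
  proof (intro conjI ballI allI impI)
    show "flexible \<G>2 C2" "p' \<in> \<G>2" by fact+
    show "i \<le> Suc k" if u: "u \<in> \<G>2" "(x, i, c) \<in> u" for u x i c
    proof -
      obtain a where "a \<in> \<G>1" "(x, i, c) \<in> a"
        using glued2[OF u(1)] u(2) unfolding glued_def by auto
      then show ?thesis by (rule ind1)
    qed
    fix i assume i: "i \<le> Suc k"
    have "\<gamma> i \<in> C1" using col(1)[of i] i by (cases "i = Suc k") (auto simp: C1_def)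
    then show "\<gamma> i \<in> C2" using C2 by blast
    show "coloured (\<gamma> i) i u" if "u \<in> \<G>2" for u
      using glued2[OF that] flexibleD(2)[OF flex1] \<open>\<gamma> i \<in> C1\<close> col1'[OF i] by (rule coloured_glued)
  qed
  show ?thesis
  proof (rule that[OF stage' _ p'(3) F])
    show "p \<subseteq> p'" using p1(2) q(2) p'(2) by blast
    show "recurs F p \<G>2 C2"
      unfolding recurs_def
    proof (intro conjI ballI allI impI)
      show "iv ` F \<subseteq> C2" by fact
      show "F \<noteq> {}" using rec2[OF q(1), of e] by (auto simp: set_prod_def)
      show "\<exists>s\<in>F. shift (s \<cdot> g) p \<subseteq> u" if "u \<in> \<G>2" "F \<odot> {g} \<subseteq> supp u" for u g
        using rec2[OF that] shift_mono[OF p1(2)] by blast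
    qed
    show "recurs F0 p0 \<G>2 C2" if rec: "recurs F0 p0 \<G> C" for F0 p0
    proof (rule recurs_glued[OF _ C2(1) glued2])
      show "recurs F0 p0 \<G>1 C1"
        unfolding recurs_def
      proof (intro conjI ballI allI impI)
        show "F0 \<noteq> {}" "iv ` F0 \<subseteq> C1" using rec by (auto simp: recurs_def C1_def)
        fix q' g assume q': "q' \<in> \<G>1" "F0 \<odot> {g} \<subseteq> supp q'"
        obtain q where q: "q \<in> \<G>" "supp q = supp q'" "q = {z \<in> q'. fst (snd z) \<noteq> Suc k}"
          using old[OF q'(1)] by blast
        have "F0 \<odot> {g} \<subseteq> supp q" using q'(2) q(2) by simp
        then obtain s where "s \<in> F0" "shift (s \<cdot> g) p0 \<subseteq> q"
          using rec q(1) unfolding recurs_def by blast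
        moreover have "q \<subseteq> q'" using q(3) by blast
        ultimately show "\<exists>s\<in>F0. shift (s \<cdot> g) p0 \<subseteq> q'" by blast
      qed
    qed
  qed
qed

text \<open>
  The stages are iterated such that every task, which is a set \<open>S n\<close> together with a group element \<open>h\<close>, comes up
  infinitely often.  At such a stage \<open>p k\<close> is made to recur along translates of \<open>iv h S n\<close> rather than of
  \<open>S n\<close>: if \<open>p k\<close> occurs at \<open>iv h s g\<close>, then the part of \<open>p k\<close> around \<open>h\<close> is found around \<open>s g\<close>.
\<close>

theorem recurrent_colouring:
  fixes S :: "nat \<Rightarrow> 'a set" and en :: "nat \<Rightarrow> 'a"
  assumes en: "surj en" and S: "\<And>n. infinite (S n)"
  obtains z :: "'a \<Rightarrow> nat \<Rightarrow> nat" where "\<And>x i. z x i < 3"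
    "\<And>x i. en i \<noteq> e \<Longrightarrow> z (en i \<cdot> x) i \<noteq> z x i"
    "\<And>n h W m. finite W \<Longrightarrow>
      \<exists>F\<subseteq>S n. finite F \<and> (\<forall>g. \<exists>s\<in>F. \<forall>w\<in>W. \<forall>i<m. z (w \<cdot> (s \<cdot> g)) i = z (w \<cdot> h) i)"
proof -
  \<comment> \<open>Index \<open>0\<close> is used up by the initial stage, hence the shift by one in the definition of \<open>z\<close> below.\<close>
  define \<gamma> where "\<gamma> i = (case i of 0 \<Rightarrow> e | Suc j \<Rightarrow> en j)" for i
  define task where "task k = (\<lambda>s. iv (en (snd (prod_decode (fst (prod_decode k))))) \<cdot> s) `
      S (fst (prod_decode (fst (prod_decode k))))" for k
  have inf_task: "infinite (task k)" for k
    unfolding task_def using S by (subst finite_image_iff) (auto simp: inj_on_def left_cancel)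
  define P where "P k = (\<lambda>(\<G>, C, p). stage \<gamma> k \<G> C p)" for k
  define Q where "Q k = (\<lambda>(\<G>, C, p :: ('a, nat \<times> nat) pattern) (\<G>', C', p'). p \<subseteq> p' \<and> en ` {..k} \<subseteq> supp p' \<and>
      (\<exists>F. finite F \<and> F \<subseteq> task k \<and> recurs F p \<G>' C') \<and>
      (\<forall>F0 p0. recurs F0 p0 \<G> C \<longrightarrow> recurs F0 p0 \<G>' C'))" for k
  have "\<exists>f. \<forall>n. P n (f n) \<and> Q n (f n) (f (Suc n))"
  proof (rule dependent_nat_choice)
    show "\<exists>s. P 0 s" using stage_0[of \<gamma>] by (auto simp: P_def \<gamma>_def)
    show "\<exists>s'. P (Suc k) s' \<and> Q k s s'" if "P k s" for s k
    proof -
      obtain \<G> C p where s: "s = (\<G>, C, p)" by (cases s)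
      have "stage \<gamma> k \<G> C p" using that by (simp add: P_def s)
      then obtain \<G>' C' p' F where "stage \<gamma> (Suc k) \<G>' C' p'" "p \<subseteq> p'" "en ` {..k} \<subseteq> supp p'"
        "finite F" "F \<subseteq> task k" "recurs F p \<G>' C'"
        "\<And>F0 p0. recurs F0 p0 \<G> C \<Longrightarrow> recurs F0 p0 \<G>' C'"
        by (rule stage_Suc[OF _ inf_task[of k], of \<gamma> k \<G> C p "en ` {..k}"]) auto
      then show ?thesis by (intro exI[of _ "(\<G>', C', p')"]) (auto simp: P_def Q_def s)
    qed
  qed
  then obtain f where f: "\<And>k. P k (f k)" "\<And>k. Q k (f k) (f (Suc k))" by metis
  define \<G> where "\<G> k = fst (f k)" for k
  define C where "C k = fst (snd (f k))" for k
  define p where "p k = snd (snd (f k))" for k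
  have st: "stage \<gamma> k (\<G> k) (C k) (p k)" for k
    using f(1)[of k] by (simp add: P_def \<G>_def C_def p_def case_prod_unfold)
  have step: "p k \<subseteq> p (Suc k)" "en ` {..k} \<subseteq> supp (p (Suc k))"
      "\<exists>F. finite F \<and> F \<subseteq> task k \<and> recurs F (p k) (\<G> (Suc k)) (C (Suc k))"
      "recurs F0 p0 (\<G> k) (C k) \<Longrightarrow> recurs F0 p0 (\<G> (Suc k)) (C (Suc k))" for k F0 p0
    using f(2)[of k] by (simp_all add: Q_def \<G>_def C_def p_def case_prod_unfold)
  have p_mono: "p k \<subseteq> p m" if "k \<le> m" for k m
    using that step(1) by (rule lift_Suc_mono_le[rotated])
  have rec_mono: "recurs F0 p0 (\<G> m) (C m)" if "k \<le> m" "recurs F0 p0 (\<G> k) (C k)" for F0 p0 k m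
    using that(1) by (induction m rule: dec_induct) (use that(2) step(4) in auto)
  have covered: "\<exists>k. \<forall>m\<ge>k. B \<subseteq> supp (p m)" if B: "finite B" for B
  proof -
    obtain I where I: "finite I" "B = en ` I"
      using finite_subset_image[OF B, of en UNIV] en by auto
    obtain k where k: "I \<subseteq> {..k}" using finite_nat_iff_bounded_le I(1) by blast
    have "B \<subseteq> supp (p m)" if "m \<ge> Suc k" for m
      using k step(2)[of k] supp_mono[OF p_mono[OF that]] I(2) by blast
    then show ?thesis by blast
  qed
  define Z where "Z = (\<Union>k. p k)"
  have col: "coloured (\<gamma> i) i (p m)" if "i \<le> m" for i m
    using st[of m] that unfolding stage_def by blast
  have Z_D: "\<exists>k. \<forall>m\<ge>k. (x, i, c) \<in> p m \<and> i \<le> m" if mem: "(x, i, c) \<in> Z" for x i c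
  proof -
    obtain k where "(x, i, c) \<in> p k" using mem by (auto simp: Z_def)
    then have "(x, i, c) \<in> p m \<and> i \<le> m" if "m \<ge> max k i" for m
      using p_mono[of k m] that by auto
    then show ?thesis by blast
  qed
  have Z_total: "\<exists>c<3. (x, i, c) \<in> Z" for x i
  proof -
    obtain k where k: "\<forall>m\<ge>k. {x} \<subseteq> supp (p m)" using covered[of "{x}"] by auto
    have "x \<in> supp (p (max k i))" using k by simp
    then show ?thesis using colouredD(1)[OF col, of i "max k i" x] by (auto simp: Z_def)
  qed
  have Z_single: "c = d" if mem: "(x, i, c) \<in> Z" "(x, i, d) \<in> Z" for x i c d
  proof -
    obtain k l where kl: "\<forall>m\<ge>k. (x, i, c) \<in> p m \<and> i \<le> m" "\<forall>m\<ge>l. (x, i, d) \<in> p m \<and> i \<le> m"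
      using Z_D mem by meson
    then have "(x, i, c) \<in> p (max k l)" "(x, i, d) \<in> p (max k l)" "i \<le> max k l" by simp_all
    then show ?thesis using colouredD(2)[OF col] by blast
  qed
  have Z_proper: "(\<gamma> i \<cdot> x, i, c) \<notin> Z" if mem: "(x, i, c) \<in> Z" "\<gamma> i \<noteq> e" for x i c
  proof
    assume "(\<gamma> i \<cdot> x, i, c) \<in> Z"
    then obtain k l where kl: "\<forall>m\<ge>k. (x, i, c) \<in> p m \<and> i \<le> m" "\<forall>m\<ge>l. (\<gamma> i \<cdot> x, i, c) \<in> p m \<and> i \<le> m"
      using Z_D mem by meson
    then have "(x, i, c) \<in> p (max k l)" "(\<gamma> i \<cdot> x, i, c) \<in> p (max k l)" "i \<le> max k l" by simp_all
    then show False using colouredD(3)[OF col mem(2)] by blast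
  qed
  define z where "z x i = (THE c. (x, Suc i, c) \<in> Z)" for x i
  have z_eq: "z x i = c \<longleftrightarrow> (x, Suc i, c) \<in> Z" for x i c
    using Z_total[of x "Suc i"] Z_single unfolding z_def by (metis the_equality)
  show ?thesis
  proof (rule that)
    show "z x i < 3" for x i
      using Z_total[of x "Suc i"] z_eq by metis
    show "z (en i \<cdot> x) i \<noteq> z x i" if "en i \<noteq> e" for x i
      using Z_proper[of x "Suc i" "z x i"] that z_eq[of x i "z x i"] z_eq[of "en i \<cdot> x" i "z x i"]
      by (simp add: \<gamma>_def)
    fix n h and W :: "'a set" and m :: nat assume W: "finite W"
    obtain j where j: "en j = h" using en by (metis surj_def)
    obtain l where l: "\<forall>m\<ge>l. (\<lambda>w. w \<cdot> h) ` W \<subseteq> supp (p m)" using covered[of "(\<lambda>w. w \<cdot> h) ` W"] W by auto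
    \<comment> \<open>A stage for the task \<open>(n, h)\<close> at which \<open>p k\<close> already covers the window around \<open>h\<close> and has its colours.\<close>
    define k where "k = prod_encode (prod_encode (n, j), max l m)"
    have k_ge: "max l m \<le> k" unfolding k_def by (rule le_prod_encode_2)
    have task: "task k = (\<lambda>s. iv h \<cdot> s) ` S n" by (simp add: task_def k_def j)
    obtain F where F: "finite F" "F \<subseteq> task k" "recurs F (p k) (\<G> (Suc k)) (C (Suc k))"
      using step(3) by blast
    obtain F' where F': "F' \<subseteq> S n" "finite F'" "F = (\<lambda>s. iv h \<cdot> s) ` F'"
      using finite_subset_image[OF F(1), of "\<lambda>s. iv h \<cdot> s" "S n"] F(2) task by auto
    have "\<exists>s\<in>F'. \<forall>w\<in>W. \<forall>i<m. z (w \<cdot> (s \<cdot> g)) i = z (w \<cdot> h) i" for g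
    proof -
      obtain l' where l': "\<forall>m\<ge>l'. F \<odot> {g} \<subseteq> supp (p m)" using covered[of "F \<odot> {g}"] F(1) by auto
      define r where "r = max l' (Suc k)"
      have "F \<odot> {g} \<subseteq> supp (p r)" using l' by (simp add: r_def)
      moreover have "recurs F (p k) (\<G> r) (C r)" using rec_mono[OF _ F(3), of r] by (simp add: r_def)
      moreover have "p r \<in> \<G> r" using st[of r] by (simp add: stage_def)
      ultimately obtain t where t: "t \<in> F" "shift (t \<cdot> g) (p k) \<subseteq> p r" unfolding recurs_def by blast
      then obtain s where s: "s \<in> F'" "t = iv h \<cdot> s" using F'(3) by blast
      have "z (w \<cdot> (s \<cdot> g)) i = z (w \<cdot> h) i" if "w \<in> W" "i < m" for w i
      proof -
        have "w \<cdot> h \<in> supp (p k)" using l k_ge that(1) by auto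
        moreover have "Suc i \<le> k" using k_ge that(2) by simp
        ultimately obtain c where c: "(w \<cdot> h, Suc i, c) \<in> p k" using colouredD(1)[OF col] by blast
        then have "(w \<cdot> h \<cdot> (t \<cdot> g), Suc i, c) \<in> shift (t \<cdot> g) (p k)" by (force simp: shift_def)
        then have "(w \<cdot> h \<cdot> (t \<cdot> g), Suc i, c) \<in> Z" using t(2) by (auto simp: Z_def)
        moreover have "w \<cdot> h \<cdot> (t \<cdot> g) = w \<cdot> (s \<cdot> g)" by (simp add: s(2) assoc)
        ultimately have "z (w \<cdot> (s \<cdot> g)) i = c" by (simp add: z_eq)
        moreover have "z (w \<cdot> h) i = c" using c by (auto simp: z_eq Z_def)
        ultimately show ?thesis by simp
      qed
      then show ?thesis using s(1) by blast
    qed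
    then show "\<exists>F\<subseteq>S n. finite F \<and> (\<forall>g. \<exists>s\<in>F. \<forall>w\<in>W. \<forall>i<m. z (w \<cdot> (s \<cdot> g)) i = z (w \<cdot> h) i)"
      using F' by blast
  qed
qed

end

section \<open>From the colouring to a flow\<close>

text \<open>
  A countably infinite group is isomorphic to one on all natural numbers.
\<close>

lemma (in Group.group) recurrent_colouring_on_carrier:
  fixes S :: "nat \<Rightarrow> 'a set"
  assumes cnt: "countable (carrier G)" "infinite (carrier G)"
    and S: "\<And>n. S n \<subseteq> carrier G" "\<And>n. infinite (S n)"
  obtains z :: "'a \<Rightarrow> 'a \<Rightarrow> nat" where "\<And>x \<gamma>. z x \<gamma> < 3"
    "\<And>x \<gamma>. x \<in> carrier G \<Longrightarrow> \<gamma> \<in> carrier G \<Longrightarrow> \<gamma> \<noteq> \<one> \<Longrightarrow> z (\<gamma> \<otimes> x) \<gamma> \<noteq> z x \<gamma>"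
    "\<And>n h W D. h \<in> carrier G \<Longrightarrow> finite W \<Longrightarrow> W \<subseteq> carrier G \<Longrightarrow> finite D \<Longrightarrow> D \<subseteq> carrier G \<Longrightarrow>
      \<exists>F\<subseteq>S n. finite F \<and>
        (\<forall>g\<in>carrier G. \<exists>s\<in>F. \<forall>w\<in>W. \<forall>\<gamma>\<in>D. z (w \<otimes> (s \<otimes> g)) \<gamma> = z (w \<otimes> h) \<gamma>)"
proof -
  define enc where "enc = to_nat_on (carrier G)"
  define dec where "dec = from_nat_into (carrier G)"
  have dec [simp]: "dec k \<in> carrier G" for k
    unfolding dec_def using cnt(2) by (intro from_nat_into) auto
  have enc_dec [simp]: "enc (dec k) = k" for k
    unfolding enc_def dec_def using cnt by simp
  have dec_enc [simp]: "dec (enc x) = x" if "x \<in> carrier G" for x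
    unfolding enc_def dec_def using cnt(1) that by simp
  interpret N: whole_group "\<lambda>m n. enc (dec m \<otimes> dec n)" "enc \<one>" "\<lambda>n. enc (inv (dec n))"
    by unfold_locales (simp_all add: m_assoc)
  have inj: "inj_on enc (S n)" for n
    by (rule inj_on_inverseI[of _ dec]) (use S(1)[of n] dec_enc in blast)
  then have inf: "infinite (enc ` S n)" for n
    using S(2) by (simp add: finite_image_iff)
  obtain y :: "nat \<Rightarrow> nat \<Rightarrow> nat" where y: "\<And>x i. y x i < 3"
    "\<And>x i. i \<noteq> enc \<one> \<Longrightarrow> y (enc (dec i \<otimes> dec x)) i \<noteq> y x i"
    "\<And>n h W m. finite W \<Longrightarrow> \<exists>F\<subseteq>enc ` S n. finite F \<and>
        (\<forall>g. \<exists>s\<in>F. \<forall>w\<in>W. \<forall>i<m. y (enc (dec w \<otimes> dec (enc (dec s \<otimes> dec g)))) i = y (enc (dec w \<otimes> dec h)) i)"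
    using N.recurrent_colouring[of id "\<lambda>n. enc ` S n"] inf by auto
  show ?thesis
  proof (rule that[of "\<lambda>x \<gamma>. y (enc x) (enc \<gamma>)"])
    show "y (enc x) (enc \<gamma>) < 3" for x \<gamma> by (rule y(1))
    show "y (enc (\<gamma> \<otimes> x)) (enc \<gamma>) \<noteq> y (enc x) (enc \<gamma>)"
      if "x \<in> carrier G" "\<gamma> \<in> carrier G" "\<gamma> \<noteq> \<one>" for x \<gamma>
    proof -
      have "enc \<gamma> \<noteq> enc \<one>" using that dec_enc by (metis one_closed)
      then show ?thesis using y(2)[of "enc \<gamma>" "enc x"] that by simp
    qed
    fix n h W D
    assume h: "h \<in> carrier G" and W: "finite W" "W \<subseteq> carrier G" and D: "finite D" "D \<subseteq> carrier G"
    obtain m where m: "enc ` D \<subseteq> {..<m}" using finite_nat_bounded D(1) by blast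
    obtain F where F: "F \<subseteq> enc ` S n" "finite F" and rec: "\<And>g. \<exists>s\<in>F. \<forall>w\<in>enc ` W. \<forall>i<m.
        y (enc (dec w \<otimes> dec (enc (dec s \<otimes> dec g)))) i = y (enc (dec w \<otimes> dec (enc h))) i"
      using y(3)[of "enc ` W" n m "enc h"] W(1) by blast
    show "\<exists>F\<subseteq>S n. finite F \<and> (\<forall>g\<in>carrier G. \<exists>s\<in>F. \<forall>w\<in>W. \<forall>\<gamma>\<in>D.
        y (enc (w \<otimes> (s \<otimes> g))) (enc \<gamma>) = y (enc (w \<otimes> h)) (enc \<gamma>))"
    proof (intro exI[of _ "dec ` F"] conjI ballI)
      show "dec ` F \<subseteq> S n" using F(1) S(1)[of n] by force
      show "finite (dec ` F)" using F(2) by simp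
      fix g assume g: "g \<in> carrier G"
      obtain s where s: "s \<in> F" "\<forall>w\<in>enc ` W. \<forall>i<m.
          y (enc (dec w \<otimes> dec (enc (dec s \<otimes> dec (enc g))))) i = y (enc (dec w \<otimes> dec (enc h))) i"
        using rec by blast
      have "y (enc (w \<otimes> (dec s \<otimes> g))) (enc \<gamma>) = y (enc (w \<otimes> h)) (enc \<gamma>)" if w: "w \<in> W" and \<gamma>: "\<gamma> \<in> D" for w \<gamma>
      proof -
        have "enc \<gamma> < m" using m \<gamma> by auto
        moreover have "w \<in> carrier G" using W(2) w by blast
        ultimately show ?thesis
          using s(2)[rule_format, OF imageI[OF w], of "enc \<gamma>"] g h by simp
      qed
      then show "\<exists>s\<in>dec ` F. \<forall>w\<in>W. \<forall>\<gamma>\<in>D. y (enc (w \<otimes> (s \<otimes> g))) (enc \<gamma>) = y (enc (w \<otimes> h)) (enc \<gamma>)"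
        using s(1) by blast
    qed
  qed
qed

text \<open>
  In a product of discrete spaces the cylinders over finite sets of coordinates form a basis.
\<close>

lemma in_closure_of_discrete_product:
  fixes y :: "'i \<Rightarrow> 'v"
  assumes "A \<subseteq> I \<rightarrow>\<^sub>E V"
  shows "y \<in> product_topology (\<lambda>_. discrete_topology V) I closure_of A \<longleftrightarrow>
    y \<in> I \<rightarrow>\<^sub>E V \<and> (\<forall>J\<subseteq>I. finite J \<longrightarrow> (\<exists>a\<in>A. \<forall>i\<in>J. a i = y i))"
    (is "?L \<longleftrightarrow> ?R")
proof
  assume L: ?L
  then have y: "y \<in> I \<rightarrow>\<^sub>E V" by (simp add: in_closure_of)
  have "\<exists>a\<in>A. \<forall>i\<in>J. a i = y i" if J: "J \<subseteq> I" "finite J" for J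
  proof -
    let ?U = "\<Pi>\<^sub>E i\<in>I. if i \<in> J then {y i} else V"
    have "finite {i \<in> I. (if i \<in> J then {y i} else V) \<noteq> V}"
      by (rule finite_subset[OF _ J(2)]) auto
    then have "openin (product_topology (\<lambda>_. discrete_topology V) I) ?U"
      using y by (auto simp: openin_PiE_gen)
    moreover have "y \<in> ?U" using y by auto
    ultimately obtain a where "a \<in> A" "a \<in> ?U" using L unfolding in_closure_of by blast
    moreover have "a i = y i" if "i \<in> J" for i
      using PiE_mem[OF \<open>a \<in> ?U\<close>, of i] that J(1) by auto
    ultimately show ?thesis by blast
  qed
  with y show ?R by blast
next
  assume R: ?R
  show ?L
    unfolding in_closure_of
  proof (intro conjI allI impI)
    show "y \<in> topspace (product_topology (\<lambda>_. discrete_topology V) I)" using R by simp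
    fix T assume "y \<in> T \<and> openin (product_topology (\<lambda>_. discrete_topology V) I) T"
    then obtain U where U: "finite {i \<in> I. U i \<noteq> V}" "y \<in> Pi\<^sub>E I U" "Pi\<^sub>E I U \<subseteq> T"
      unfolding openin_product_topology_alt by auto
    define J where "J = {i \<in> I. U i \<noteq> V}"
    have "J \<subseteq> I" "finite J" using U(1) by (auto simp: J_def)
    then have "\<exists>a\<in>A. \<forall>i\<in>J. a i = y i" using R by simp
    then obtain a where a: "a \<in> A" "\<forall>i\<in>J. a i = y i" by auto
    have aV: "a \<in> I \<rightarrow>\<^sub>E V" using a(1) assms by (rule subsetD[rotated])
    have "a i \<in> U i" if "i \<in> I" for i
    proof (cases "i \<in> J")
      case True
      then show ?thesis using a(2) PiE_mem[OF U(2) that] by simp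
    next
      case False
      then show ?thesis using PiE_mem[OF aV that] that by (simp add: J_def)
    qed
    then have "a \<in> Pi\<^sub>E I U" using aV by (simp add: PiE_iff)
    then show "\<exists>a. a \<in> A \<and> a \<in> T" using a(1) U(3) by blast
  qed
qed

lemma group_actionI:
  assumes "Group.group G"
    and closed: "\<And>g x. g \<in> carrier G \<Longrightarrow> x \<in> E \<Longrightarrow> \<phi> g x \<in> E"
    and ext: "\<And>g. g \<in> carrier G \<Longrightarrow> \<phi> g \<in> extensional E"
    and one: "\<And>x. x \<in> E \<Longrightarrow> \<phi> \<one>\<^bsub>G\<^esub> x = x"
    and mult: "\<And>g h x. g \<in> carrier G \<Longrightarrow> h \<in> carrier G \<Longrightarrow> x \<in> E \<Longrightarrow> \<phi> (g \<otimes>\<^bsub>G\<^esub> h) x = \<phi> g (\<phi> h x)"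
  shows "group_action G E \<phi>"
proof -
  interpret G: Group.group G by fact
  have bij: "\<phi> g \<in> Bij E" if g: "g \<in> carrier G" for g
  proof -
    have "bij_betw (\<phi> g) E E"
    proof (rule bij_betw_byWitness[where f' = "\<phi> (inv\<^bsub>G\<^esub> g)"])
      show "\<forall>x\<in>E. \<phi> (inv\<^bsub>G\<^esub> g) (\<phi> g x) = x" "\<forall>x\<in>E. \<phi> g (\<phi> (inv\<^bsub>G\<^esub> g) x) = x"
        using mult[of "inv\<^bsub>G\<^esub> g" g] mult[of g "inv\<^bsub>G\<^esub> g"] g one by auto
    qed (use closed g in auto)
    then show ?thesis using ext[OF g] by (simp add: Bij_def)
  qed
  have "\<phi> (g \<otimes>\<^bsub>G\<^esub> h) = compose E (\<phi> g) (\<phi> h)" if "g \<in> carrier G" "h \<in> carrier G" for g h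
    using that mult ext[of "g \<otimes>\<^bsub>G\<^esub> h"] by (auto simp: compose_def extensional_def fun_eq_iff)
  then have "\<phi> \<in> hom G (BijGroup E)"
    using bij by (auto simp: hom_def BijGroup_def)
  then show ?thesis
    unfolding group_action_def group_hom_def group_hom_axioms_def
    using G.is_group group_BijGroup by blast
qed

text \<open>
  Topology and action are transported along an injection \<open>\<iota>\<close> into the type from which the points of the flow
  have to be taken.
\<close>

lemma free_flow_of_injection:
  fixes Y :: "'y topology" and \<iota> :: "'y \<Rightarrow> 'x" and a :: "'g \<Rightarrow> 'y \<Rightarrow> 'y" and G :: "('g, 'm) monoid_scheme"
  assumes G: "Group.group G" and Y: "topspace Y \<noteq> {}" "compact_space Y" "Hausdorff_space Y"
    and inj: "inj_on \<iota> (topspace Y)"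
    and cont: "\<And>g. g \<in> carrier G \<Longrightarrow> continuous_map Y Y (a g)"
    and one: "\<And>y. y \<in> topspace Y \<Longrightarrow> a \<one>\<^bsub>G\<^esub> y = y"
    and mult: "\<And>g h y. g \<in> carrier G \<Longrightarrow> h \<in> carrier G \<Longrightarrow> y \<in> topspace Y \<Longrightarrow> a (g \<otimes>\<^bsub>G\<^esub> h) y = a g (a h y)"
    and free: "\<And>g y. g \<in> carrier G \<Longrightarrow> g \<noteq> \<one>\<^bsub>G\<^esub> \<Longrightarrow> y \<in> topspace Y \<Longrightarrow> a g y \<noteq> y"
  obtains X :: "'x topology" and \<phi> where "free_flow G X \<phi>"
    "\<And>S. S \<subseteq> carrier G \<Longrightarrow> (\<And>y. y \<in> topspace Y \<Longrightarrow> (Y closure_of ((\<lambda>s. a s y) ` S)) = topspace Y) \<Longrightarrow>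
      minimal_on S X \<phi>"
proof -
  define \<kappa> where "\<kappa> = inv_into (topspace Y) \<iota>"
  define X where "X = pullback_topology (\<iota> ` topspace Y) \<kappa> Y"
  define \<phi> where "\<phi> g = (\<lambda>x\<in>\<iota> ` topspace Y. \<iota> (a g (\<kappa> x)))" for g
  have \<kappa>\<iota> [simp]: "\<kappa> (\<iota> y) = y" if "y \<in> topspace Y" for y
    unfolding \<kappa>_def using inj that by simp
  have topX: "topspace X = \<iota> ` topspace Y"
    unfolding X_def topspace_pullback_topology by auto
  have cont_\<kappa>: "continuous_map X Y \<kappa>"
    unfolding X_def using continuous_map_pullback[of Y Y id] by (simp add: comp_def id_def)
  have cont_\<iota>: "continuous_map Y X \<iota>"
    unfolding X_def
    by (rule continuous_map_pullback') (auto intro: continuous_map_eq[OF continuous_map_id])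
  have homeo: "homeomorphic_maps Y X \<iota> \<kappa>"
    unfolding homeomorphic_maps_def using cont_\<kappa> cont_\<iota> topX by auto
  then have hmap: "homeomorphic_map Y X \<iota>" by (rule homeomorphic_maps_map[THEN iffD1, THEN conjunct1])
  then have "Y homeomorphic_space X" by (rule homeomorphic_map_imp_homeomorphic_space)
  then have "compact_space X" "Hausdorff_space X"
    using Y homeomorphic_compact_space homeomorphic_Hausdorff_space by blast+
  have a_closed: "a g y \<in> topspace Y" if "g \<in> carrier G" "y \<in> topspace Y" for g y
    using cont[OF that(1)] that(2) by (auto simp: continuous_map_def)
  have \<phi>\<iota> [simp]: "\<phi> g (\<iota> y) = \<iota> (a g y)" if "y \<in> topspace Y" for g y
    using that by (simp add: \<phi>_def)
  have "group_action G (topspace X) \<phi>"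
    unfolding topX
  proof (rule group_actionI[OF G])
    show "\<phi> g \<in> extensional (\<iota> ` topspace Y)" for g by (simp add: \<phi>_def)
  qed (use a_closed one mult in auto)
  moreover have "continuous_map (prod_topology (discrete_topology (carrier G)) X) X (\<lambda>(g, x). \<phi> g x)"
    unfolding continuous_map_def
  proof (intro conjI allI impI)
    show "(\<lambda>(g, x). \<phi> g x) \<in> topspace (prod_topology (discrete_topology (carrier G)) X) \<rightarrow> topspace X"
      using a_closed by (auto simp: topX)
    fix U assume U: "openin X U"
    have "openin X {x \<in> topspace X. \<phi> g x \<in> U}" if g: "g \<in> carrier G" for g
    proof -
      have "continuous_map X X (\<iota> \<circ> a g \<circ> \<kappa>)"
        using cont_\<kappa> cont[OF g] cont_\<iota> by (intro continuous_map_compose)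
      then have "continuous_map X X (\<phi> g)"
        by (rule continuous_map_eq) (auto simp: topX)
      then show ?thesis using U by (simp add: continuous_map_def)
    qed
    then have "openin (prod_topology (discrete_topology (carrier G)) X)
        (\<Union>g\<in>carrier G. {g} \<times> {x \<in> topspace X. \<phi> g x \<in> U})"
      by (intro openin_Union) (auto simp: openin_prod_Times_iff)
    also have "(\<Union>g\<in>carrier G. {g} \<times> {x \<in> topspace X. \<phi> g x \<in> U})
      = {x \<in> topspace (prod_topology (discrete_topology (carrier G)) X). (case x of (g, x) \<Rightarrow> \<phi> g x) \<in> U}"
      by auto
    finally show "openin (prod_topology (discrete_topology (carrier G)) X)
        {x \<in> topspace (prod_topology (discrete_topology (carrier G)) X). (case x of (g, x) \<Rightarrow> \<phi> g x) \<in> U}" .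
  qed
  moreover have "free_action G (topspace X) \<phi>"
    unfolding free_action_def topX using free a_closed inj by (auto simp: inj_on_eq_iff)
  ultimately have "free_flow G X \<phi>"
    using Y(1) \<open>compact_space X\<close> \<open>Hausdorff_space X\<close> by (auto simp: free_flow_def flow_def topX)
  moreover have "minimal_on S X \<phi>"
    if S: "S \<subseteq> carrier G" and dense: "\<And>y. y \<in> topspace Y \<Longrightarrow> Y closure_of ((\<lambda>s. a s y) ` S) = topspace Y" for S
    unfolding minimal_on_def
  proof
    fix x assume "x \<in> topspace X"
    then obtain y where y: "y \<in> topspace Y" "x = \<iota> y" by (auto simp: topX)
    have "(\<lambda>s. \<phi> s x) ` S = \<iota> ` (\<lambda>s. a s y) ` S" using y by (auto simp: image_image)
    moreover have "(\<lambda>s. a s y) ` S \<subseteq> topspace Y" using S a_closed y(1) by auto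
    ultimately have "X closure_of ((\<lambda>s. \<phi> s x) ` S) = \<iota> ` (Y closure_of ((\<lambda>s. a s y) ` S))"
      using homeomorphic_map_closure_of[OF hmap] by simp
    then show "X closure_of ((\<lambda>s. \<phi> s x) ` S) = topspace X" using dense[OF y(1)] topX by simp
  qed
  ultimately show ?thesis by (rule that)
qed

theorem theorem1p3:
  fixes G :: "('g, 'm) monoid_scheme" and S :: "nat \<Rightarrow> 'g set"
  assumes "group G"
    and "countable (carrier G)" and "infinite (carrier G)"
    and "\<And>n. S n \<subseteq> carrier G" and "\<And>n. infinite (S n)"
  shows "\<exists>(X :: flow_point topology) \<phi>. free_flow G X \<phi> \<and> (\<forall>n. minimal_on (S n) X \<phi>)"
proof -
  interpret G: Group.group G by fact
  define I where "I = carrier G \<times> carrier G"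
  define Y0 :: "('g \<times> 'g \<Rightarrow> nat) topology" where "Y0 = product_topology (\<lambda>_. discrete_topology {..<3}) I"
  obtain z :: "'g \<Rightarrow> 'g \<Rightarrow> nat" where z3: "\<And>x \<gamma>. z x \<gamma> < 3"
    and z_proper: "\<And>x \<gamma>. x \<in> carrier G \<Longrightarrow> \<gamma> \<in> carrier G \<Longrightarrow> \<gamma> \<noteq> \<one>\<^bsub>G\<^esub> \<Longrightarrow> z (\<gamma> \<otimes>\<^bsub>G\<^esub> x) \<gamma> \<noteq> z x \<gamma>"
    and z_rec: "\<And>n h W D. h \<in> carrier G \<Longrightarrow> finite W \<Longrightarrow> W \<subseteq> carrier G \<Longrightarrow> finite D \<Longrightarrow> D \<subseteq> carrier G \<Longrightarrow>
      \<exists>F\<subseteq>S n. finite F \<and> (\<forall>g\<in>carrier G. \<exists>s\<in>F. \<forall>w\<in>W. \<forall>\<gamma>\<in>D.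
        z (w \<otimes>\<^bsub>G\<^esub> (s \<otimes>\<^bsub>G\<^esub> g)) \<gamma> = z (w \<otimes>\<^bsub>G\<^esub> h) \<gamma>)"
    by (rule G.recurrent_colouring_on_carrier[OF assms(2,3,4,5)]) (rule that)
  define orb where "orb g = (\<lambda>(x, \<gamma>)\<in>I. z (x \<otimes>\<^bsub>G\<^esub> g) \<gamma>)" for g
  define K where "K = Y0 closure_of (orb ` carrier G)"
  define Y where "Y = subtopology Y0 K"
  define a where "a h y = (\<lambda>(x, \<gamma>)\<in>I. y (x \<otimes>\<^bsub>G\<^esub> h, \<gamma>))" for h and y :: "'g \<times> 'g \<Rightarrow> nat"
  have topY0: "topspace Y0 = I \<rightarrow>\<^sub>E {..<3}" by (simp add: Y0_def)
  have orb_sub: "orb ` carrier G \<subseteq> I \<rightarrow>\<^sub>E {..<3}" using z3 by (auto simp: orb_def)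
  have K_sub: "K \<subseteq> I \<rightarrow>\<^sub>E {..<3}" unfolding K_def topY0[symmetric] by (rule closure_of_subset_topspace)
  have topY: "topspace Y = K" using K_sub by (auto simp: Y_def topY0)
  have K_approx: "\<exists>g\<in>carrier G. \<forall>i\<in>J. y i = orb g i" if "y \<in> K" "finite J" "J \<subseteq> I" for y J
  proof -
    have "\<exists>b\<in>orb ` carrier G. \<forall>i\<in>J. b i = y i"
      using that unfolding K_def Y0_def in_closure_of_discrete_product[OF orb_sub] by simp
    then obtain g where "g \<in> carrier G" "\<forall>i\<in>J. orb g i = y i" by (elim bexE imageE) simp
    then show ?thesis by (intro bexI[of _ g]) simp_all
  qed
  have orb_K: "orb g \<in> K" if "g \<in> carrier G" for g
    using closure_of_subset[of "orb ` carrier G" Y0] orb_sub that by (auto simp: topY0 K_def)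
  have cont0: "continuous_map Y0 Y0 (a h)" if h: "h \<in> carrier G" for h
    unfolding Y0_def continuous_map_componentwise
  proof (intro conjI ballI)
    show "a h ` topspace (product_topology (\<lambda>_. discrete_topology {..<3}) I) \<subseteq> extensional I"
      by (auto simp: a_def)
    fix k assume k: "k \<in> I"
    have "continuous_map (product_topology (\<lambda>_. discrete_topology {..<3}) I) (discrete_topology {..<3::nat})
        (\<lambda>y. y (fst k \<otimes>\<^bsub>G\<^esub> h, snd k))"
      by (rule continuous_map_product_projection) (use k h in \<open>auto simp: I_def\<close>)
    then show "continuous_map (product_topology (\<lambda>_. discrete_topology {..<3}) I) (discrete_topology {..<3})
        (\<lambda>y. a h y k)"
      using k by (simp add: a_def case_prod_unfold)
  qed
  have a_orb: "a h (orb g) = orb (h \<otimes>\<^bsub>G\<^esub> g)" if "h \<in> carrier G" "g \<in> carrier G" for h g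
    using that by (auto simp: a_def orb_def I_def G.m_assoc fun_eq_iff)
  have a_K: "a h ` K \<subseteq> K" if h: "h \<in> carrier G" for h
  proof -
    have "a h ` K \<subseteq> Y0 closure_of (a h ` orb ` carrier G)"
      unfolding K_def using cont0[OF h] by (rule continuous_map_image_closure_subset)
    also have "\<dots> \<subseteq> K"
      unfolding K_def by (rule closure_of_mono) (use h in \<open>auto simp: a_orb\<close>)
    finally show ?thesis .
  qed
  have a_apply: "a h y (x, \<gamma>) = y (x \<otimes>\<^bsub>G\<^esub> h, \<gamma>)" if "x \<in> carrier G" "\<gamma> \<in> carrier G" for h y x \<gamma>
    using that by (simp add: a_def I_def)
  define enc where "enc = to_nat_on (carrier G)"
  \<comment> \<open>A point is encoded by the singleton of its graph, with arguments and value coded as one number.\<close>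
  define code :: "('g \<times> 'g \<Rightarrow> nat) \<Rightarrow> flow_point" where
    "code y = {(\<lambda>(x, \<gamma>). prod_encode (prod_encode (enc x, enc \<gamma>), y (x, \<gamma>))) ` I}" for y
  have enc_inj: "enc x = enc x' \<longleftrightarrow> x = x'" if "x \<in> carrier G" "x' \<in> carrier G" for x x'
    unfolding enc_def using assms(2) that by (simp add: inj_on_eq_iff[OF inj_on_to_nat_on])
  have code_inj: "inj_on code (topspace Y)"
  proof (rule inj_onI)
    fix y y' assume y: "y \<in> topspace Y" "y' \<in> topspace Y" and eq: "code y = code y'"
    show "y = y'"
    proof (rule extensionalityI[of _ I])
      show "y \<in> extensional I" "y' \<in> extensional I" using y K_sub by (auto simp: topY PiE_def)
      fix i assume i: "i \<in> I"
      obtain x \<gamma> where x: "i = (x, \<gamma>)" "x \<in> carrier G" "\<gamma> \<in> carrier G" using i by (auto simp: I_def)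
      have "prod_encode (prod_encode (enc x, enc \<gamma>), y (x, \<gamma>))
          \<in> (\<lambda>(x, \<gamma>). prod_encode (prod_encode (enc x, enc \<gamma>), y (x, \<gamma>))) ` I"
        using i x(1) by (intro image_eqI[of _ _ "(x, \<gamma>)"]) simp_all
      also have "\<dots> = (\<lambda>(x, \<gamma>). prod_encode (prod_encode (enc x, enc \<gamma>), y' (x, \<gamma>))) ` I"
        using eq by (simp add: code_def)
      finally show "y i = y' i" using x by (auto simp: I_def enc_inj)
    qed
  qed
  obtain X :: "flow_point topology" and \<phi> where X: "free_flow G X \<phi>"
    and min: "\<And>S. S \<subseteq> carrier G \<Longrightarrow>
      (\<And>y. y \<in> topspace Y \<Longrightarrow> (Y closure_of ((\<lambda>s. a s y) ` S)) = topspace Y) \<Longrightarrow> minimal_on S X \<phi>"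
  proof (rule free_flow_of_injection[OF assms(1) _ _ _ code_inj, of a])
    show "topspace Y \<noteq> {}" unfolding topY using orb_K[OF G.one_closed] by blast
    have "compact_space Y0" by (simp add: Y0_def compact_space_product_topology compact_space_discrete_topology)
    then show "compact_space Y"
      unfolding Y_def K_def by (intro compact_space_subtopology closedin_compact_space closedin_closure_of)
    have "Hausdorff_space Y0" by (simp add: Y0_def Hausdorff_space_product_topology)
    then show "Hausdorff_space Y" unfolding Y_def by (rule Hausdorff_space_subtopology)
    show "continuous_map Y Y (a g)" if "g \<in> carrier G" for g
      unfolding Y_def using cont0[OF that] a_K[OF that]
      by (intro continuous_map_into_subtopology continuous_map_from_subtopology) auto
    show "a \<one>\<^bsub>G\<^esub> y = y" if "y \<in> topspace Y" for y
      using that K_sub by (auto simp: topY a_def I_def fun_eq_iff PiE_def extensional_def)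
    show "a (g \<otimes>\<^bsub>G\<^esub> h) y = a g (a h y)" if "g \<in> carrier G" "h \<in> carrier G" for g h y
      using that by (auto simp: a_def I_def G.m_assoc fun_eq_iff)
    show "a g y \<noteq> y" if g: "g \<in> carrier G" "g \<noteq> \<one>\<^bsub>G\<^esub>" and y: "y \<in> topspace Y" for g y
    proof
      assume fixed: "a g y = y"
      obtain h where h: "h \<in> carrier G" "\<forall>i\<in>{(g, g), (\<one>\<^bsub>G\<^esub>, g)}. y i = orb h i"
        using K_approx[of y "{(g, g), (\<one>\<^bsub>G\<^esub>, g)}"] y g(1) by (auto simp: topY I_def)
      have "y (g, g) = y (\<one>\<^bsub>G\<^esub>, g)"
        using a_apply[of "\<one>\<^bsub>G\<^esub>" g g y] g(1) fixed by simp
      then have "z (g \<otimes>\<^bsub>G\<^esub> h) g = z h g" using h g(1) by (simp add: orb_def I_def)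
      then show False using z_proper[OF h(1) g] by simp
    qed
    fix X :: "flow_point topology" and \<phi>
    assume "free_flow G X \<phi>" and "\<And>S. S \<subseteq> carrier G \<Longrightarrow>
      (\<And>y. y \<in> topspace Y \<Longrightarrow> (Y closure_of ((\<lambda>s. a s y) ` S)) = topspace Y) \<Longrightarrow> minimal_on S X \<phi>"
    then show thesis by (rule that)
  qed
  have "minimal_on (S n) X \<phi>" for n
  proof (rule min[OF assms(4)])
    fix y assume "y \<in> topspace Y"
    then have y: "y \<in> K" by (simp add: topY)
    have aS: "(\<lambda>s. a s y) ` S n \<subseteq> K" using a_K assms(4)[of n] y by blast
    have "y' \<in> Y0 closure_of ((\<lambda>s. a s y) ` S n)" if y': "y' \<in> K" for y'
      unfolding Y0_def
    proof (subst in_closure_of_discrete_product, intro subset_trans[OF aS K_sub], intro conjI allI impI)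
      show "y' \<in> I \<rightarrow>\<^sub>E {..<3}" using y' K_sub by blast
      fix J assume J: "J \<subseteq> I" "finite J"
      obtain h where h: "h \<in> carrier G" "\<forall>i\<in>J. y' i = orb h i" using K_approx[OF y' J(2,1)] by blast
      have J': "finite (fst ` J)" "fst ` J \<subseteq> carrier G" "finite (snd ` J)" "snd ` J \<subseteq> carrier G"
        using J by (auto simp: I_def)
      obtain F where F: "F \<subseteq> S n" "finite F" and rec: "\<And>g. g \<in> carrier G \<Longrightarrow> \<exists>s\<in>F. \<forall>w\<in>fst ` J. \<forall>\<gamma>\<in>snd ` J.
          z (w \<otimes>\<^bsub>G\<^esub> (s \<otimes>\<^bsub>G\<^esub> g)) \<gamma> = z (w \<otimes>\<^bsub>G\<^esub> h) \<gamma>"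
        using z_rec[OF h(1) J', of n] by blast
      have F_sub: "F \<subseteq> carrier G" using F(1) assms(4) by blast
      \<comment> \<open>These finitely many coordinates of \<open>y\<close> decide for all \<open>s \<in> F\<close> at once how \<open>a s y\<close> looks on \<open>J\<close>.\<close>
      let ?J = "(\<lambda>((w, \<gamma>), s). (w \<otimes>\<^bsub>G\<^esub> s, \<gamma>)) ` (J \<times> F)"
      have "finite ?J" "?J \<subseteq> I" using J F F_sub by (auto simp: I_def)
      then obtain g where g: "g \<in> carrier G" "\<forall>i\<in>?J. y i = orb g i" using K_approx[OF y] by blast
      obtain s where s: "s \<in> F" "\<forall>w\<in>fst ` J. \<forall>\<gamma>\<in>snd ` J.
          z (w \<otimes>\<^bsub>G\<^esub> (s \<otimes>\<^bsub>G\<^esub> g)) \<gamma> = z (w \<otimes>\<^bsub>G\<^esub> h) \<gamma>" using rec[OF g(1)] by blast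
      have "a s y i = y' i" if i: "i \<in> J" for i
      proof -
        obtain w \<gamma> where w: "i = (w, \<gamma>)" "w \<in> carrier G" "\<gamma> \<in> carrier G" using i J by (auto simp: I_def)
        have "s \<in> carrier G" using s(1) F_sub by blast
        have "a s y i = y (w \<otimes>\<^bsub>G\<^esub> s, \<gamma>)" using w by (simp add: a_apply)
        also have "\<dots> = orb g (w \<otimes>\<^bsub>G\<^esub> s, \<gamma>)" using g(2) i w(1) s(1) by force
        also have "\<dots> = z (w \<otimes>\<^bsub>G\<^esub> (s \<otimes>\<^bsub>G\<^esub> g)) \<gamma>"
          using w \<open>s \<in> carrier G\<close> g(1) by (simp add: orb_def I_def G.m_assoc)
        also have "\<dots> = z (w \<otimes>\<^bsub>G\<^esub> h) \<gamma>" using s(2) i w(1) by force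
        also have "\<dots> = orb h i" using w by (simp add: orb_def I_def)
        also have "\<dots> = y' i" using h(2) i by simp
        finally show ?thesis .
      qed
      then show "\<exists>b\<in>(\<lambda>s. a s y) ` S n. \<forall>i\<in>J. b i = y' i" using s(1) F(1) by blast
    qed
    then show "Y closure_of ((\<lambda>s. a s y) ` S n) = topspace Y"
      unfolding Y_def closure_of_subtopology using aS K_sub by (auto simp: Int_absorb1 topY0)
  qed
  then show ?thesis using X by blast
qed

end
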